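(* Let $q\ge 1$, $\gamma\in\{0,\ldots,q-1\}$, $u>0$ and $K<0$ be fixed. For every $d\ge q+1$ let $\mathbf{L}$ be a random element of $G_K(d,q)$ with distribution $\nu_{q,K}$ and let $\mathbf{E}$ be a random element of $A_K(d,d-q+\gamma)$, independent of $\mathbf{L}$, whose distribution is the restriction of $C_K(d,d-q+\gamma,u)^{-1}\mu_{d-q+\gamma,K}$ to $[uB_K^d]_{d-q+\gamma,K}$. Then $$\lim_{d\to\infty}\mathbb{P}(\mathbf{E}\cap\mathbf{L}\neq\varnothing)=0.$$
   Context: For $K<0$, $\mathbb{M}_K^d$ is the $d$-dimensional simply connected complete space of constant sectional curvature $K$ (hyperbolic space), with Riemannian distance $d_K$ and a fixed point $o$ (the origin). $uB_K^d:=\{x\in\mathbb{M}_K^d: d_K(x,o)\le u\}$. For a dimension $k$, a $k$-flat is a $k$-dimensional totally geodesic submanifold of $\mathbb{M}_K^d$ (complete, i.e. in the Beltrami-Klein model a non-empty intersection of a $k$-dimensional affine subspace of $\mathbb{R}^d$ with the open Euclidean ball of radius $1/\sqrt{-K}$). $A_K(d,k)$ is the space of all $k$-flats, $G_K(d,k)$ the space of all $k$-flats passing through $o$. $\nu_{k,K}$ is the unique Borel probability measure on $G_K(d,k)$ invariant under all isometries of $\mathbb{M}_K^d$ fixing $o$. $\mu_{k,K}$ is the isometry-invariant measure on $A_K(d,k)$ normalized as $$\mu_{k,K}(\cdot)=\int_{G_K(d,d-k)}\int_L\mathbf{1}\{E(L,x)\in\cdot\}\cosh^k(\sqrt{-K}\,d_K(x,o))\,\mathcal{H}_K^{d-k}(\mathrm{d}x)\,\nu_{d-k,K}(\mathrm{d}L),$$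 where $E(L,x)$ is the unique $k$-flat passing through $x$ orthogonally to $L$ and $\mathcal{H}_K^{d-k}$ is the $(d-k)$-dimensional Hausdorff measure with respect to $d_K$. $[uB_K^d]_{k,K}:=\{E\in A_K(d,k):E\cap uB_K^d\neq\varnothing\}$. For $n\in\mathbb{N}$, $\omega_n:=2\pi^{n/2}/\Gamma(n/2)$. Moreover $$C_K(d,k,u):=\mu_{k,K}([uB_K^d]_{k,K})=\omega_{d-k}(\sqrt{-K})^{-d+k+1}\int_0^u\cosh^k(\sqrt{-K}r)\sinh^{d-k-1}(\sqrt{-K}r)\,\mathrm{d}r.$$ *)

theory Defs
  imports "HOL-Probability.Probability" "HOL-Analysis.Finite_Function_Topology"
begin

text \<open>
  The dimension \<open>d\<close> tends to infinity, so it cannot be a type parameter.  Euclidean \<open>d\<close>-space is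
  therefore the subspace of those finitely supported real sequences whose support lies in
  \<open>{..<d}\<close>.  The library norm on this type is the sum norm; only its vector space structure is used,
  and the Euclidean inner product is given explicitly.
\<close>

type_synonym point = "nat \<Rightarrow>\<^sub>0 real"

definition ip :: "point \<Rightarrow> point \<Rightarrow> real" where
  "ip x y = (\<Sum>i\<in>Poly_Mapping.keys x. Poly_Mapping.lookup x i * Poly_Mapping.lookup y i)"

definition coord_space :: "nat \<Rightarrow> point set" where
  "coord_space d = {x. Poly_Mapping.keys x \<subseteq> {..<d}}"


text \<open>The Beltrami-Klein model of hyperbolic space of curvature \<open>K < 0\<close>; the origin is \<open>0\<close>.\<close>

definition hyp :: "real \<Rightarrow> nat \<Rightarrow> point set" where
  "hyp K d = {x \<in> coord_space d. sqrt (ip x x) < 1 / sqrt (- K)}"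

text \<open>
  The value \<open>0\<close> outside the open ball is irrelevant; it keeps the function nonnegative and symmetric
  on the whole type, as \<^locale>\<open>Metric_space\<close> demands.
\<close>

definition hyp_dist :: "real \<Rightarrow> point \<Rightarrow> point \<Rightarrow> real" where
  "hyp_dist K x y =
     (if sqrt (ip x x) < 1 / sqrt (- K) \<and> sqrt (ip y y) < 1 / sqrt (- K)
      then arcosh ((1 + K * ip x y) / sqrt ((1 + K * ip x x) * (1 + K * ip y y))) / sqrt (- K)
      else 0)"

text \<open>The Riemannian metric tensor of the model at the point \<open>x\<close>.\<close>

definition hyp_tensor :: "real \<Rightarrow> point \<Rightarrow> point \<Rightarrow> point \<Rightarrow> real" where
  "hyp_tensor K x v w =
     ip v w / (1 + K * ip x x) - K * ip x v * ip x w / (1 + K * ip x x)\<^sup>2"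

definition hyp_top :: "real \<Rightarrow> nat \<Rightarrow> point topology" where
  "hyp_top K d = Metric_space.mtopology (hyp K d) (hyp_dist K)"

definition hyp_cball :: "real \<Rightarrow> nat \<Rightarrow> real \<Rightarrow> point set" where
  "hyp_cball K d u = {x \<in> hyp K d. hyp_dist K x 0 \<le> u}"

definition isometries_fixing_origin :: "real \<Rightarrow> nat \<Rightarrow> (point \<Rightarrow> point) set" where
  "isometries_fixing_origin K d =
     {g. bij_betw g (hyp K d) (hyp K d) \<and> g 0 = 0 \<and>
         (\<forall>x\<in>hyp K d. \<forall>y\<in>hyp K d. hyp_dist K (g x) (g y) = hyp_dist K x y)}"


definition flats :: "real \<Rightarrow> nat \<Rightarrow> nat \<Rightarrow> point set set" where
  "flats K d k =
     {A \<inter> hyp K d | A. affine A \<and> A \<subseteq> coord_space d \<and>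
        dim {x - y | x y. x \<in> A \<and> y \<in> A} = k \<and> A \<inter> hyp K d \<noteq> {}}"

definition flats0 :: "real \<Rightarrow> nat \<Rightarrow> nat \<Rightarrow> point set set" where
  "flats0 K d k = {L \<in> flats K d k. 0 \<in> L}"

definition hitting_flats :: "real \<Rightarrow> nat \<Rightarrow> nat \<Rightarrow> real \<Rightarrow> point set set" where
  "hitting_flats K d k u = {E \<in> flats K d k. E \<inter> hyp_cball K d u \<noteq> {}}"

text \<open>
  In the Klein model a flat is a relatively open piece of an affine subspace, so its tangent space
  at \<open>x\<close> is spanned by the vectors \<open>y - x\<close> with \<open>y\<close> in the flat.
\<close>

definition orthogonal_at :: "real \<Rightarrow> point \<Rightarrow> point set \<Rightarrow> point set \<Rightarrow> bool" where
  "orthogonal_at K x E L \<longleftrightarrow> (\<forall>y\<in>E. \<forall>z\<in>L. hyp_tensor K x (y - x) (z - x) = 0)"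

definition orth_flat :: "real \<Rightarrow> nat \<Rightarrow> nat \<Rightarrow> point set \<Rightarrow> point \<Rightarrow> point set" where
  "orth_flat K d k L x = (THE E. E \<in> flats K d k \<and> x \<in> E \<and> orthogonal_at K x E L)"


text \<open>
  Spaces of flats carry the Fell topology of the closed subsets of hyperbolic space, the usual
  topology of stochastic geometry, and its Borel \<open>\<sigma>\<close>-algebra.
\<close>

definition fell_topology :: "'a topology \<Rightarrow> 'a set topology" where
  "fell_topology X = topology_generated_by
     ({{F. closedin X F \<and> F \<inter> U \<noteq> {}} | U. openin X U} \<union>
      {{F. closedin X F \<and> F \<inter> C = {}} | C. compactin X C})"

definition flat_opens :: "real \<Rightarrow> nat \<Rightarrow> point set set \<Rightarrow> point set set set" where
  "flat_opens K d S = {U. openin (subtopology (fell_topology (hyp_top K d)) S) U}"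

definition flats_borel :: "real \<Rightarrow> nat \<Rightarrow> nat \<Rightarrow> point set measure" where
  "flats_borel K d k = sigma (flats K d k) (flat_opens K d (flats K d k))"

definition flats0_borel :: "real \<Rightarrow> nat \<Rightarrow> nat \<Rightarrow> point set measure" where
  "flats0_borel K d k = sigma (flats0 K d k) (flat_opens K d (flats0 K d k))"


text \<open>
  The \<open>m\<close>-dimensional Hausdorff measure of a metric space, normalized so that it agrees with
  Lebesgue measure on Euclidean \<open>m\<close>-space and with Riemannian volume on \<open>m\<close>-dimensional
  submanifolds.  The empty set is treated separately because of \<open>0 ^ 0 = 1\<close>.
\<close>

definition ediam :: "('a \<Rightarrow> 'a \<Rightarrow> real) \<Rightarrow> 'a set \<Rightarrow> ennreal" where
  "ediam \<rho> A = (SUP x\<in>A. SUP y\<in>A. ennreal (\<rho> x y))"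

definition hausdorff_gauge :: "('a \<Rightarrow> 'a \<Rightarrow> real) \<Rightarrow> nat \<Rightarrow> 'a set \<Rightarrow> ennreal" where
  "hausdorff_gauge \<rho> m A =
     (if A = {} then 0 else ennreal (unit_ball_vol (real m)) * (ediam \<rho> A / 2) ^ m)"

definition hausdorff_outer ::
  "'a set \<Rightarrow> ('a \<Rightarrow> 'a \<Rightarrow> real) \<Rightarrow> nat \<Rightarrow> 'a set \<Rightarrow> ennreal" where
  "hausdorff_outer X \<rho> m A =
     (SUP \<delta>\<in>{0<..}.
        INF U\<in>{U :: nat \<Rightarrow> 'a set. (\<forall>i. U i \<subseteq> X \<and> ediam \<rho> (U i) \<le> ennreal \<delta>) \<and> A \<subseteq> (\<Union>i. U i)}.
          suminf (\<lambda>i. hausdorff_gauge \<rho> m (U i)))"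

definition hausdorff_measure ::
  "'a set \<Rightarrow> ('a \<Rightarrow> 'a \<Rightarrow> real) \<Rightarrow> nat \<Rightarrow> 'a measure" where
  "hausdorff_measure X \<rho> m =
     measure_of X {U. openin (Metric_space.mtopology X \<rho>) U} (hausdorff_outer X \<rho> m)"


text \<open>
  For \<open>k \<le> d\<close> exactly one measure has this property: the isometries fixing the origin act on the
  Grassmannian as the compact transitive group \<open>O(d)\<close>.
\<close>

definition invariant_probability :: "real \<Rightarrow> nat \<Rightarrow> nat \<Rightarrow> point set measure \<Rightarrow> bool" where
  "invariant_probability K d k \<nu> \<longleftrightarrow>
     prob_space \<nu> \<and> space \<nu> = flats0 K d k \<and> sets \<nu> = sets (flats0_borel K d k) \<and>
     (\<forall>g\<in>isometries_fixing_origin K d. \<forall>B\<in>sets \<nu>.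
        emeasure \<nu> {L \<in> flats0 K d k. g ` L \<in> B} = emeasure \<nu> B)"

text \<open>
  The invariant measure on \<open>k\<close>-flats; \<open>\<nu>\<close> is the invariant probability measure on the
  \<open>(d - k)\<close>-flats through the origin.
\<close>

definition flat_measure ::
  "real \<Rightarrow> nat \<Rightarrow> nat \<Rightarrow> point set measure \<Rightarrow> point set measure" where
  "flat_measure K d k \<nu> =
     measure_of (flats K d k) (flat_opens K d (flats K d k))
       (\<lambda>B. \<integral>\<^sup>+ L. (\<integral>\<^sup>+ x\<in>L. indicator B (orth_flat K d k L x) *
                         ennreal (cosh (sqrt (- K) * hyp_dist K x 0) ^ k)
                    \<partial>hausdorff_measure (hyp K d) (hyp_dist K) (d - k)) \<partial>\<nu>)"

end

theory Submission
  imports Defs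
begin

text \<open>
  Write \<open>m = q - \<gamma>\<close>, so that \<open>E\<close> has codimension \<open>m\<close>.  In the Klein model, the flat through \<open>x\<close>
  orthogonal to a flat \<open>V\<close> through the origin is the slice of the ball by the Euclidean affine space
  \<open>x + V\<^sup>\<bottom>\<close> (lemma \<open>orth_flat_eq\<close>).  All points \<open>y\<close> of such a flat satisfy
  \<open>\<langle>y, x\<rangle> = \<bar>x\<bar>\<^sup>2\<close>.  The flat \<open>E\<close> can therefore meet \<open>L\<close> only if its foot point \<open>x\<close> is near the origin or
  if \<open>L\<close> contains a point whose component in the direction of \<open>x\<close> is bounded below.  Both
  events become improbable in high dimension.

  \<^item> \<open>L\<close> is nearly orthogonal to any given direction.  A \<open>q\<close>-dimensional subspace can
    have large components along only boundedly many of the \<open>d\<close> coordinate axes, by Parseval's identity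
    (\<open>card_reached_axes_le\<close>).  By invariance all directions are equally likely to be reached, so the
    probability of reaching a given one is \<open>O(1/d)\<close> (\<open>prob_reaching_flats_le\<close>).

  \<^item> The foot point is far from the origin.  Its density with respect to hyperbolic volume on \<open>V\<close>,
    up to the distance \<open>u\<close>, is proportional to the power \<open>cosh\<^sup>d\<^sup>-\<^sup>m\<close> of the scaled distance.  A
    hyperbolic isometry of \<open>V\<close> moves the ball of radius \<open>r = u / 4\<close> about the origin into the shell
    between the radii \<open>2 r\<close> and \<open>u\<close>, so the ball has at most the volume of the shell
    (\<open>hausdorff_ball_le_shell\<close>), while the density is exponentially larger on the shell.

  Independence is used for events rather than for product measures: the flats with foot point
  away from the origin are covered by countably many measurable classes, one for each vector of a
  countable dense set, and each class forces \<open>L\<close> to reach its vector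
  (\<open>prob_hitting_le\<close>).

  That the integral formula defines a measure \<open>\<mu>\<close> and that the flats hitting a ball form a measurable
  set of finite positive measure is drawn from the distribution of \<open>E\<close>: it is a probability measure,
  and a uniform distribution can only be one in this case (\<open>prob_space_uniform_measureD\<close>).
\<close>

section \<open>Euclidean geometry of finitely supported sequences\<close>

abbreviation coord :: "point \<Rightarrow> nat \<Rightarrow> real" where
  "coord \<equiv> Poly_Mapping.lookup"

abbreviation unit_vec :: "nat \<Rightarrow> point" where
  "unit_vec i \<equiv> Poly_Mapping.single i 1"

lemma coord_scaleR [simp]: "coord (r *\<^sub>R x) i = r * coord x i" for x :: point
proof -
  have "finite {i. r * coord x i \<noteq> 0}"
    by (rule finite_subset[OF _ finite_keys[of x]]) (auto simp: in_keys_iff)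
  then show ?thesis by (simp add: scaleR_poly_mapping_def)
qed

lemma coord_sum [simp]: "coord (\<Sum>a\<in>A. f a) i = (\<Sum>a\<in>A. coord (f a) i)" for f :: "'a \<Rightarrow> point"
  by (induction A rule: infinite_finite_induct) (auto simp: lookup_add)

lemma ip_eq_sum: "finite S \<Longrightarrow> Poly_Mapping.keys x \<subseteq> S \<Longrightarrow> ip x y = (\<Sum>i\<in>S. coord x i * coord y i)"
  unfolding ip_def by (rule sum.mono_neutral_left) (auto simp: in_keys_iff)

lemma ip_commute: "ip x y = ip y x"
proof -
  let ?S = "Poly_Mapping.keys x \<union> Poly_Mapping.keys y"
  show ?thesis by (simp add: ip_eq_sum[of ?S x] ip_eq_sum[of ?S y] mult.commute)
qed

lemma ip_add_left: "ip (x + y) z = ip x z + ip y z"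
proof -
  let ?S = "Poly_Mapping.keys x \<union> Poly_Mapping.keys y"
  have "ip (x + y) z = (\<Sum>i\<in>?S. coord (x + y) i * coord z i)"
    by (rule ip_eq_sum) (auto simp: Poly_Mapping.keys_add)
  then show ?thesis
    by (simp add: ip_eq_sum[of ?S x] ip_eq_sum[of ?S y] lookup_add algebra_simps sum.distrib)
qed

lemma ip_scaleR_left: "ip (r *\<^sub>R x) z = r * ip x z"
proof -
  have "Poly_Mapping.keys (r *\<^sub>R x) \<subseteq> Poly_Mapping.keys x"
    by (auto simp: in_keys_iff)
  then have "ip (r *\<^sub>R x) z = (\<Sum>i\<in>Poly_Mapping.keys x. coord (r *\<^sub>R x) i * coord z i)"
    by (intro ip_eq_sum) auto
  then show ?thesis by (simp add: ip_def sum_distrib_left algebra_simps)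
qed

lemma ip_zero_left [simp]: "ip 0 x = 0" by (simp add: ip_def)
lemma ip_zero_right [simp]: "ip x 0 = 0" by (simp add: ip_commute[of x])

lemma ip_add_right: "ip z (x + y) = ip z x + ip z y"
  by (simp add: ip_commute[of z] ip_add_left)
lemma ip_scaleR_right: "ip z (r *\<^sub>R x) = r * ip z x"
  by (simp add: ip_commute[of z] ip_scaleR_left)
lemma ip_minus_left: "ip (- x) z = - ip x z"
  using ip_scaleR_left[of "-1" x z] by simp
lemma ip_minus_right: "ip z (- x) = - ip z x"
  by (simp add: ip_commute[of z] ip_minus_left)
lemma ip_diff_left: "ip (x - y) z = ip x z - ip y z"
  using ip_add_left[of x "- y" z] by (simp add: ip_minus_left)
lemma ip_diff_right: "ip z (x - y) = ip z x - ip z y"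
  by (simp add: ip_commute[of z] ip_diff_left)
lemma ip_sum_left: "ip (\<Sum>a\<in>A. f a) z = (\<Sum>a\<in>A. ip (f a) z)"
  by (induction A rule: infinite_finite_induct) (auto simp: ip_add_left)
lemma ip_sum_right: "ip z (\<Sum>a\<in>A. f a) = (\<Sum>a\<in>A. ip z (f a))"
  by (simp add: ip_commute[of z] ip_sum_left)

lemmas ip_linear = ip_add_left ip_add_right ip_scaleR_left ip_scaleR_right ip_minus_left
  ip_minus_right ip_diff_left ip_diff_right

lemma ip_self_nonneg [simp]: "0 \<le> ip x x"
  by (simp add: ip_def sum_nonneg)

lemma ip_self_eq_0_iff [simp]: "ip x x = 0 \<longleftrightarrow> x = 0"
proof
  assume "ip x x = 0"
  then have "\<forall>i\<in>Poly_Mapping.keys x. coord x i * coord x i = 0"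
    by (simp add: ip_def sum_nonneg_eq_0_iff)
  then show "x = 0"
    by (intro poly_mapping_eqI) (auto simp: in_keys_iff)
qed simp

lemma ip_self_pos_iff [simp]: "0 < ip x x \<longleftrightarrow> x \<noteq> 0"
  using ip_self_nonneg[of x] ip_self_eq_0_iff[of x] by linarith

lemma ip_Cauchy_Schwarz: "(ip x y)\<^sup>2 \<le> ip x x * ip y y"
proof -
  let ?S = "Poly_Mapping.keys x \<union> Poly_Mapping.keys y"
  show ?thesis
    using Cauchy_Schwarz_ineq_sum[of "coord x" "coord y" ?S]
    by (simp add: ip_eq_sum[of ?S x] ip_eq_sum[of ?S y] power2_eq_square)
qed

lemma abs_ip_le: "\<bar>ip x y\<bar> \<le> sqrt (ip x x) * sqrt (ip y y)"
  using ip_Cauchy_Schwarz[of x y]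
  by (metis real_sqrt_abs real_sqrt_le_iff real_sqrt_mult)

lemma ip_unit_vec [simp]: "ip x (unit_vec i) = coord x i" "ip (unit_vec i) x = coord x i"
proof -
  show "ip (unit_vec i) x = coord x i" by (simp add: ip_def)
  then show "ip x (unit_vec i) = coord x i" by (simp add: ip_commute)
qed

subsection \<open>Orthonormal sets\<close>

definition orthonormal :: "point set \<Rightarrow> bool" where
  "orthonormal C \<longleftrightarrow> finite C \<and> (\<forall>c\<in>C. \<forall>c'\<in>C. ip c c' = (if c = c' then 1 else 0))"

lemma orthonormalD:
  assumes "orthonormal C"
  shows "finite C" and "c \<in> C \<Longrightarrow> c' \<in> C \<Longrightarrow> ip c c' = (if c = c' then 1 else 0)"
  using assms by (auto simp: orthonormal_def)

lemma orthonormal_subset: "orthonormal C \<Longrightarrow> B \<subseteq> C \<Longrightarrow> orthonormal B"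
  unfolding orthonormal_def by (meson finite_subset subsetD)

lemma orthonormal_ip_sum:
  assumes "orthonormal C" "c \<in> C"
  shows "ip (\<Sum>c\<in>C. u c *\<^sub>R c) c = u c"
proof -
  have "ip (\<Sum>c\<in>C. u c *\<^sub>R c) c = (\<Sum>c'\<in>C. if c' = c then u c else 0)"
    unfolding ip_sum_left ip_scaleR_left
    using orthonormalD(2)[OF assms(1) _ assms(2)] by (intro sum.cong) auto
  then show ?thesis using assms(2) orthonormalD(1)[OF assms(1)] by simp
qed

lemma orthonormal_expansion:
  assumes "orthonormal C" "x \<in> span C"
  shows "x = (\<Sum>c\<in>C. ip x c *\<^sub>R c)"
proof -
  obtain u where u: "x = (\<Sum>c\<in>C. u c *\<^sub>R c)"
    using assms by (auto simp: span_finite[OF orthonormalD(1)[OF assms(1)]])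
  then have "ip x c = u c" if "c \<in> C" for c
    using orthonormal_ip_sum[OF assms(1) that] by simp
  then have "(\<Sum>c\<in>C. ip x c *\<^sub>R c) = (\<Sum>c\<in>C. u c *\<^sub>R c)"
    by (intro sum.cong) auto
  then show ?thesis using u by simp
qed

lemma orthonormal_Parseval:
  assumes "orthonormal C" "x \<in> span C"
  shows "ip x x = (\<Sum>c\<in>C. (ip x c)\<^sup>2)"
proof -
  have "ip x x = ip x (\<Sum>c\<in>C. ip x c *\<^sub>R c)"
    using orthonormal_expansion[OF assms] by simp
  then show ?thesis by (simp add: ip_sum_right ip_scaleR_right power2_eq_square)
qed

lemma orthonormal_independent: "orthonormal C \<Longrightarrow> independent C"
proof (rule real_vector.independent_if_scalars_zero)
  fix u c assume C: "orthonormal C" and 0: "(\<Sum>c\<in>C. u c *\<^sub>R c) = 0" and "c \<in> C"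
  then show "u c = 0" using orthonormal_ip_sum[of C c u] by simp
qed (simp add: orthonormalD(1))

lemma orthonormal_card: "orthonormal C \<Longrightarrow> card C = dim (span C)"
  by (simp add: orthonormal_independent real_vector.dim_eq_card_independent)

text \<open>
  Gram-Schmidt orthonormalization.  It starts from a given \<open>C\<close>, so that it yields bases of a space
  which extend bases of a subspace.
\<close>

lemma Gram_Schmidt:
  assumes "finite B" "orthonormal C"
  shows "\<exists>C'. C \<subseteq> C' \<and> orthonormal C' \<and> span C' = span (C \<union> B)"
  using assms(1)
proof (induction B)
  case empty
  then show ?case using assms(2) by auto
next
  case (insert b B)
  then obtain C' where C': "C \<subseteq> C'" "orthonormal C'" "span C' = span (C \<union> B)" by blast
  have step: "span (insert b C') = span (C \<union> insert b B)"
    by (simp add: span_insert C'(3))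
  define p where "p = (\<Sum>c\<in>C'. ip b c *\<^sub>R c)"
  define b' where "b' = b - p"
  have p: "p \<in> span C'"
    unfolding p_def by (intro span_sum span_scale span_base)
  have orth: "ip b' c = 0" if "c \<in> C'" for c
    using orthonormal_ip_sum[OF C'(2) that, of "ip b"] by (simp add: b'_def p_def ip_diff_left)
  show ?case
  proof (cases "b' = 0")
    case True
    then have "b \<in> span C'" using p by (simp add: b'_def)
    then show ?thesis
      using C' step by (metis real_vector.span_redundant)
  next
    case False
    define e where "e = (1 / sqrt (ip b' b')) *\<^sub>R b'"
    have "ip e e = 1"
      using False by (simp add: e_def ip_linear field_simps flip: power2_eq_square)
    moreover have "ip e c = 0" "ip c e = 0" if "c \<in> C'" for c
      using orth[OF that] by (simp_all add: e_def ip_linear ip_commute[of c])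
    ultimately have "orthonormal (insert e C')"
      using C'(2) by (auto simp: orthonormal_def)
    moreover have "span (insert e C') = span (insert b C')"
    proof (rule subset_antisym; rule span_minimal)
      have "b \<in> span (insert b C')" "p \<in> span (insert b C')"
        using p span_mono[of C' "insert b C'"] by (auto intro: span_base)
      then have "e \<in> span (insert b C')"
        unfolding e_def b'_def by (intro span_scale span_diff)
      then show "insert e C' \<subseteq> span (insert b C')"
        by (auto intro: span_base)
      have "b = p + sqrt (ip b' b') *\<^sub>R e"
        using False by (simp add: e_def b'_def)
      moreover have "p \<in> span (insert e C')"
        using p span_mono[of C' "insert e C'"] by auto
      ultimately have "b \<in> span (insert e C')"
        by (metis insertI1 span_add span_base span_scale)
      then show "insert b C' \<subseteq> span (insert e C')"
        by (auto intro: span_base)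
    qed auto
    ultimately show ?thesis using C'(1) step by (metis subset_insertI2)
  qed
qed

subsection \<open>Subspaces and orthogonal complements\<close>

lemma coord_space_iff: "x \<in> coord_space d \<longleftrightarrow> (\<forall>i\<ge>d. coord x i = 0)"
  unfolding coord_space_def by (auto simp: in_keys_iff subset_iff not_less[symmetric])

lemma subspace_coord_space: "subspace (coord_space d)"
  by (auto simp: subspace_def coord_space_iff lookup_add)

lemma unit_vec_inj: "unit_vec i = unit_vec j \<longleftrightarrow> i = j"
  by (metis lookup_single_eq lookup_single_not_eq zero_neq_one)

lemma orthonormal_unit_vecs: "orthonormal (unit_vec ` {..<d})"
  by (auto simp: orthonormal_def lookup_single unit_vec_inj when_def)

lemma span_unit_vecs: "span (unit_vec ` {..<d}) = coord_space d"
proof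
  show "span (unit_vec ` {..<d}) \<subseteq> coord_space d"
    by (rule span_minimal[OF _ subspace_coord_space])
      (auto simp: coord_space_iff lookup_single when_def)
  show "coord_space d \<subseteq> span (unit_vec ` {..<d})"
  proof
    fix x assume "x \<in> coord_space d"
    then have "x = (\<Sum>i<d. coord x i *\<^sub>R unit_vec i)"
      by (intro poly_mapping_eqI)
        (auto simp: coord_space_iff lookup_single when_def if_distrib[of "(*) _"] cong: if_cong)
    also have "\<dots> \<in> span (unit_vec ` {..<d})"
      by (intro span_sum span_scale span_base) auto
    finally show "x \<in> span (unit_vec ` {..<d})" .
  qed
qed

lemma dim_coord_space: "dim (coord_space d) = d"
  using orthonormal_card[OF orthonormal_unit_vecs, of d]
  by (simp add: span_unit_vecs card_image inj_on_def unit_vec_inj)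

lemma orthonormal_basis_extend:
  assumes U: "subspace U" "U \<subseteq> coord_space d" and C: "orthonormal C" "C \<subseteq> U"
  obtains C' where "C \<subseteq> C'" "orthonormal C'" "span C' = U"
proof -
  obtain B where B: "B \<subseteq> U" "independent B" "U \<subseteq> span B"
    using real_vector.basis_exists by metis
  have "B \<subseteq> span (unit_vec ` {..<d})" using B(1) U(2) span_unit_vecs by auto
  then have "finite B"
    using real_vector.independent_span_bound[OF _ B(2)] by blast
  then obtain C' where C': "C \<subseteq> C'" "orthonormal C'" "span C' = span (C \<union> B)"
    using Gram_Schmidt C(1) by blast
  moreover have "span (C \<union> B) = U"
    using B C U(1) span_mono[of B "C \<union> B"] by (intro subset_antisym span_minimal) auto
  ultimately show ?thesis using that by metis
qed

lemma orthonormal_basis_exists: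
  assumes "subspace U" "U \<subseteq> coord_space d"
  obtains C where "orthonormal C" "span C = U" "card C = dim U"
proof -
  have "orthonormal {}" by (simp add: orthonormal_def)
  then obtain C where "orthonormal C" "span C = U"
    using orthonormal_basis_extend[OF assms, of "{}"] by blast
  then show ?thesis using that orthonormal_card by metis
qed

text \<open>
  An orthonormal basis of \<open>U\<close> extends to one of \<open>W\<close>, which has the same cardinality and so is the
  same set.
\<close>

lemma subspace_eq_if_dim_eq:
  assumes "subspace U" "subspace W" "U \<subseteq> W" "W \<subseteq> coord_space d" "dim U = dim W"
  shows "U = W"
proof -
  obtain C where C: "orthonormal C" "span C = U" "card C = dim U"
    using orthonormal_basis_exists[of U d] assms by auto
  moreover have "C \<subseteq> W" using C(2) assms(3) span_superset by blast
  ultimately obtain C' where C': "C \<subseteq> C'" "orthonormal C'" "span C' = W"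
    using orthonormal_basis_extend[OF assms(2,4)] by blast
  have "card C' = card C" using C C' assms(5) orthonormal_card by metis
  then have "C = C'" using C'(1,2) by (simp add: card_subset_eq orthonormalD(1))
  then show ?thesis using C C' by simp
qed

definition orth_compl :: "nat \<Rightarrow> point set \<Rightarrow> point set" where
  "orth_compl d V = {w \<in> coord_space d. \<forall>v\<in>V. ip w v = 0}"

lemma subspace_orth_compl: "subspace (orth_compl d V)"
  using subspace_coord_space[of d] by (auto simp: subspace_def orth_compl_def ip_linear)

lemma orth_compl_subset: "orth_compl d V \<subseteq> coord_space d"
  by (auto simp: orth_compl_def)

text \<open>
  A basis adapted to the splitting into \<open>V\<close> and its complement; the dimension of the complement
  can be read off.
\<close>

lemma orth_compl_basis:
  assumes V: "subspace V" "V \<subseteq> coord_space d"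
  obtains C C' where "C \<subseteq> C'" "orthonormal C'" "span C' = coord_space d"
    "span C = V" "span (C' - C) = orth_compl d V"
proof -
  obtain C where C: "orthonormal C" "span C = V"
    using orthonormal_basis_exists[OF V] by metis
  then have "C \<subseteq> coord_space d" using V(2) span_superset by blast
  then obtain C' where C': "C \<subseteq> C'" "orthonormal C'" "span C' = coord_space d"
    using orthonormal_basis_extend[OF subspace_coord_space subset_refl] C(1) by metis
  have "span (C' - C) = orth_compl d V"
  proof
    have "ip c v = 0" if "c \<in> C' - C" "v \<in> V" for c v
    proof -
      have v: "v = (\<Sum>c\<in>C. ip v c *\<^sub>R c)" using orthonormal_expansion C that by metis
      have "ip c v = (\<Sum>c'\<in>C. ip v c' * ip c c')"
        by (subst v) (simp add: ip_sum_right ip_scaleR_right)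
      also have "\<dots> = 0"
      proof (intro sum.neutral ballI)
        fix c' assume "c' \<in> C"
        then have "ip c c' = 0" using that C' by (auto simp: orthonormalD(2)[OF C'(2)])
        then show "ip v c' * ip c c' = 0" by simp
      qed
      finally show ?thesis .
    qed
    moreover have "C' \<subseteq> coord_space d" using C'(3) span_superset by blast
    ultimately show "span (C' - C) \<subseteq> orth_compl d V"
      by (intro span_minimal[OF _ subspace_orth_compl]) (auto simp: orth_compl_def)
    show "orth_compl d V \<subseteq> span (C' - C)"
    proof
      fix w assume w: "w \<in> orth_compl d V"
      then have "w = (\<Sum>c\<in>C'. ip w c *\<^sub>R c)"
        using orthonormal_expansion[OF C'(2)] C'(3) orth_compl_subset by blast
      also have "\<dots> = (\<Sum>c\<in>C' - C. ip w c *\<^sub>R c)"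
      proof (rule sum.mono_neutral_right)
        show "\<forall>c\<in>C' - (C' - C). ip w c *\<^sub>R c = 0"
          using w C(2) span_superset[of C] by (auto simp: orth_compl_def)
      qed (use C' in \<open>auto simp: orthonormalD\<close>)
      also have "\<dots> \<in> span (C' - C)"
        by (intro span_sum span_scale span_base)
      finally show "w \<in> span (C' - C)" .
    qed
  qed
  then show ?thesis using that C C' by blast
qed

lemma dim_orth_compl:
  assumes "subspace V" "V \<subseteq> coord_space d"
  shows "dim (orth_compl d V) = d - dim V"
proof -
  obtain C C' where C: "C \<subseteq> C'" "orthonormal C'" "span C' = coord_space d"
    "span C = V" "span (C' - C) = orth_compl d V"
    using orth_compl_basis[OF assms] .
  have "card C' = d" "card C = dim V" "card (C' - C) = dim (orth_compl d V)"
    using C orthonormal_card orthonormal_subset dim_coord_space by (metis Diff_subset)+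
  then show ?thesis
    using C by (metis card_Diff_subset finite_subset orthonormalD(1))
qed

lemma orth_compl_orth_compl:
  assumes "subspace V" "V \<subseteq> coord_space d"
  shows "orth_compl d (orth_compl d V) = V"
proof -
  let ?W = "orth_compl d V"
  have "dim V \<le> d"
    using real_vector.dim_le_card[of V "unit_vec ` {..<d}"] assms(2)
      card_image_le[of "{..<d}" unit_vec] by (simp add: span_unit_vecs)
  then have "dim V = dim (orth_compl d ?W)"
    using assms by (simp add: dim_orth_compl subspace_orth_compl orth_compl_subset)
  moreover have "V \<subseteq> orth_compl d ?W"
    using assms(2) by (auto simp: orth_compl_def ip_commute)
  ultimately show ?thesis
    using subspace_eq_if_dim_eq[OF assms(1) subspace_orth_compl] orth_compl_subset by metis
qed

section \<open>The metric of the Beltrami-Klein model\<close>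

text \<open>
  This is the product of the vectors \<open>(1, x)\<close> and \<open>(1, y)\<close> for the Lorentzian form that maps \<open>(s, v)\<close>
  and \<open>(t, w)\<close> to \<open>s t + K \<langle>v, w\<rangle>\<close>; normalized, these vectors represent the points in the hyperboloid
  model.
\<close>

definition lor :: "real \<Rightarrow> point \<Rightarrow> point \<Rightarrow> real" where
  "lor K x y = 1 + K * ip x y"

lemma lor_zero [simp]: "lor K 0 x = 1" "lor K x 0 = 1"
  by (simp_all add: lor_def)

lemma norm_less_iff_lor: 
  assumes "K < 0"
  shows "sqrt (ip x x) < 1 / sqrt (- K) \<longleftrightarrow> 0 < lor K x x"
proof -
  have "1 / sqrt (- K) = sqrt (1 / - K)" by (simp only: real_sqrt_divide real_sqrt_one)
  then have "sqrt (ip x x) < 1 / sqrt (- K) \<longleftrightarrow> ip x x < 1 / - K"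
    by (simp only: real_sqrt_less_iff)
  also have "\<dots> \<longleftrightarrow> 0 < lor K x x"
    using assms by (auto simp: lor_def field_simps)
  finally show ?thesis .
qed

lemma hyp_iff: "K < 0 \<Longrightarrow> x \<in> hyp K d \<longleftrightarrow> x \<in> coord_space d \<and> 0 < lor K x x"
  by (simp add: hyp_def norm_less_iff_lor)

lemma zero_in_hyp [simp]: "K < 0 \<Longrightarrow> 0 \<in> hyp K d"
  by (simp add: hyp_iff coord_space_iff)

lemma lor_self_le_1: "K < 0 \<Longrightarrow> lor K x x \<le> 1"
  by (simp add: lor_def mult_nonpos_nonneg)

lemma lor_pos:
  assumes "K < 0" "0 < lor K x x" "0 < lor K y y"
  shows "0 < lor K x y"
proof -
  have "(K * ip x y)\<^sup>2 \<le> (K * ip x x) * (K * ip y y)"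
    using mult_left_mono[OF ip_Cauchy_Schwarz[of x y], of "K\<^sup>2"]
    by (simp add: power2_eq_square algebra_simps)
  also have "\<dots> < 1 * 1"
  proof -
    have "0 \<le> - K * ip x x" "- K * ip x x < 1" "0 \<le> - K * ip y y" "- K * ip y y < 1"
      using assms by (auto simp: lor_def mult_nonpos_nonneg)
    from mult_strict_mono'[OF this(2,4,1,3)] show ?thesis by simp
  qed
  finally have "\<bar>K * ip x y\<bar> < 1" by (simp add: abs_square_less_1)
  then show ?thesis by (simp add: lor_def)
qed

text \<open>
  The reversed Cauchy-Schwarz inequality of Lorentzian geometry, with a quantitative gap.  The two
  sides differ by \<open>K\<^sup>2 \<langle>x - y, y\<rangle>\<^sup>2\<close>.
\<close>

lemma lor_gap:
  assumes "K < 0"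
  shows "- K * ip (x - y) (x - y) * lor K y y \<le> (lor K x y)\<^sup>2 - lor K x x * lor K y y"
proof -
  have "(lor K x y)\<^sup>2 - lor K x x * lor K y y
      = - K * ip (x - y) (x - y) - K\<^sup>2 * (ip (x - y) (x - y) * ip y y - (ip (x - y) y)\<^sup>2)"
    by (simp add: lor_def ip_linear ip_commute[of y x] power2_eq_square algebra_simps)
  moreover have "- K * ip (x - y) (x - y) * lor K y y
      = - K * ip (x - y) (x - y) - K\<^sup>2 * (ip (x - y) (x - y) * ip y y)"
    by (simp add: lor_def power2_eq_square algebra_simps)
  ultimately show ?thesis
    by (simp add: right_diff_distrib)
qed

lemma lor_ratio_ge_1:
  assumes "K < 0" "0 < lor K x x" "0 < lor K y y"
  shows "1 \<le> lor K x y / sqrt (lor K x x * lor K y y)"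
proof -
  have "0 \<le> - K * ip (x - y) (x - y) * lor K y y"
    using assms by (simp add: mult_nonpos_nonneg)
  then have "lor K x x * lor K y y \<le> (lor K x y)\<^sup>2"
    using lor_gap[OF assms(1), of x y] by linarith
  then have "sqrt (lor K x x * lor K y y) \<le> lor K x y"
    using lor_pos[OF assms] by (intro real_le_lsqrt) auto
  then show ?thesis using assms by simp
qed

lemma hyp_dist_eq:
  assumes "K < 0" "0 < lor K x x" "0 < lor K y y"
  shows "hyp_dist K x y = arcosh (lor K x y / sqrt (lor K x x * lor K y y)) / sqrt (- K)"
  using assms norm_less_iff_lor[OF assms(1)] by (simp add: hyp_dist_def lor_def)

lemma hyp_dist_nonneg [simp]:
  assumes "K < 0"
  shows "0 \<le> hyp_dist K x y"
proof (cases "0 < lor K x x \<and> 0 < lor K y y")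
  case True
  then show ?thesis using assms lor_ratio_ge_1[of K x y] by (simp add: hyp_dist_eq)
next
  case False
  then show ?thesis using norm_less_iff_lor[OF assms] by (auto simp: hyp_dist_def)
qed

lemma hyp_dist_commute: "hyp_dist K x y = hyp_dist K y x"
  by (auto simp: hyp_dist_def ip_commute mult.commute)

lemma cosh_hyp_dist:
  assumes "K < 0" "0 < lor K x x" "0 < lor K y y"
  shows "cosh (sqrt (- K) * hyp_dist K x y) = lor K x y / sqrt (lor K x x * lor K y y)"
  using assms lor_ratio_ge_1[OF assms] by (simp add: hyp_dist_eq)

text \<open>
  The squared hyperbolic sine is the gap of the reversed Cauchy-Schwarz inequality divided by
  \<open>lor K x x * lor K y y\<close>, and \<open>lor K x x \<le> 1\<close>.  Through this bound Euclidean continuity carries over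
  to the model.
\<close>

lemma euclid_le_sinh_hyp_dist:
  assumes "K < 0" "0 < lor K x x" "0 < lor K y y"
  shows "- K * ip (x - y) (x - y) \<le> (sinh (sqrt (- K) * hyp_dist K x y))\<^sup>2"
proof -
  have "- K * ip (x - y) (x - y) * (lor K x x * lor K y y) \<le> - K * ip (x - y) (x - y) * lor K y y"
    using assms lor_self_le_1[of K x]
    by (intro mult_left_mono) (auto intro!: mult_left_le_one_le mult_nonpos_nonneg)
  also have "\<dots> \<le> (lor K x y)\<^sup>2 - lor K x x * lor K y y"
    by (rule lor_gap[OF assms(1)])
  finally have "- K * ip (x - y) (x - y)
      \<le> ((lor K x y)\<^sup>2 - lor K x x * lor K y y) / (lor K x x * lor K y y)"
    using assms by (simp add: pos_le_divide_eq)
  also have "\<dots> = (lor K x y / sqrt (lor K x x * lor K y y))\<^sup>2 - 1"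
    using assms by (simp add: power_divide diff_divide_distrib)
  also have "\<dots> = (sinh (sqrt (- K) * hyp_dist K x y))\<^sup>2"
    by (simp add: sinh_square_eq cosh_hyp_dist[OF assms])
  finally show ?thesis .
qed

lemma hyp_dist_eq_0_iff:
  assumes "K < 0" "0 < lor K x x" "0 < lor K y y"
  shows "hyp_dist K x y = 0 \<longleftrightarrow> x = y"
proof
  assume "hyp_dist K x y = 0"
  then have "- K * ip (x - y) (x - y) \<le> 0"
    using euclid_le_sinh_hyp_dist[OF assms] by simp
  then have "ip (x - y) (x - y) \<le> 0" using assms(1) by (auto simp: zero_le_mult_iff)
  then have "ip (x - y) (x - y) = 0" using ip_self_nonneg[of "x - y"] by linarith
  then show "x = y" by simp
next
  assume "x = y"
  then show "hyp_dist K x y = 0" using assms by (simp add: hyp_dist_eq)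
qed

subsection \<open>The reflection exchanging the origin and a given point\<close>

text \<open>
  In the hyperboloid model the reflection in the bisector of the segment from the origin to \<open>p\<close> is
  the Lorentzian reflection along the difference of the two points; this is its expression in the
  Klein model.  It reduces questions about an arbitrary point to questions about the origin.  (For
  \<open>p = 0\<close> the formula gives the identity.)
\<close>

definition swap_origin :: "real \<Rightarrow> point \<Rightarrow> point \<Rightarrow> point" where
  "swap_origin K p x = (let s = sqrt (lor K p p) in
     (1 / lor K x p) *\<^sub>R (s *\<^sub>R x + ((lor K x p - s) / (1 - s)) *\<^sub>R p))"

text \<open>
  The extra factors cancel in the ratio that defines the distance, so the map is an isometry.
\<close>

lemma lor_swap_origin:
  assumes "K < 0" "0 < lor K p p" "lor K x p \<noteq> 0" "lor K y p \<noteq> 0"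
  shows "lor K (swap_origin K p x) (swap_origin K p y)
    = lor K p p * lor K x y / (lor K x p * lor K y p)"
proof (cases "p = 0")
  case True
  then show ?thesis by (simp add: swap_origin_def)
next
  case False
  define s where "s = sqrt (lor K p p)"
  have "lor K p p < 1" using False assms(1) by (simp add: lor_def mult_neg_pos)
  then have s1: "s \<noteq> 1" by (auto simp: s_def)
  have s2: "s * s = lor K p p" using assms(2) by (simp add: s_def flip: power2_eq_square)
  define a b where "a = lor K x p" and "b = lor K y p"
  define a' b' where "a' = (a - s) / (1 - s)" and "b' = (b - s) / (1 - s)"
  have pp: "K * ip p p = s * s - 1" and xp: "K * ip x p = a - 1" and yp: "K * ip y p = b - 1"
    and xy: "K * ip x y = lor K x y - 1"
    by (simp_all add: s2 a_def b_def lor_def)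
  have ab: "a \<noteq> 0" "b \<noteq> 0" using assms by (simp_all add: a_def b_def)
  have "K * ip (swap_origin K p x) (swap_origin K p y) * (a * b)
      = K * ip (s *\<^sub>R x + a' *\<^sub>R p) (s *\<^sub>R y + b' *\<^sub>R p)"
    using ab by (simp add: swap_origin_def Let_def s_def[symmetric] a_def[symmetric]
        b_def[symmetric] a'_def b'_def ip_scaleR_left ip_scaleR_right)
  also have "\<dots> = s * s * (K * ip x y) + s * b' * (K * ip x p) + s * a' * (K * ip y p)
      + a' * b' * (K * ip p p)"
    by (simp add: ip_linear ip_commute[of p y] algebra_simps)
  also have "\<dots> = s * s * lor K x y - a * b"
  proof -
    have "(a - s) = a' * (1 - s)" "(b - s) = b' * (1 - s)"
      using s1 by (simp_all add: a'_def b'_def)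
    then have "a = a' * (1 - s) + s" "b = b' * (1 - s) + s" by simp_all
    then show ?thesis unfolding pp xp yp xy
      by (simp only:) (simp add: algebra_simps)
  qed
  finally show ?thesis
    using ab by (simp add: lor_def[of K "swap_origin K p x"] s2 a_def[symmetric] b_def[symmetric]
      field_simps)
qed

context
  fixes K :: real and p :: point and d :: nat
  assumes K: "K < 0" and p: "p \<in> hyp K d"
begin

lemma swap_origin_0 [simp]: "swap_origin K p 0 = p"
  using K p by (cases "p = 0")
    (auto simp: swap_origin_def Let_def lor_def mult_less_0_iff hyp_iff)

lemma swap_origin_subspace:
  "subspace V \<Longrightarrow> p \<in> V \<Longrightarrow> x \<in> V \<Longrightarrow> swap_origin K p x \<in> V"
  by (simp add: swap_origin_def Let_def subspace_scale subspace_add)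

lemma swap_origin_in_hyp:
  assumes "x \<in> hyp K d"
  shows "swap_origin K p x \<in> hyp K d"
proof -
  have "0 < lor K x p" using assms p K lor_pos by (simp add: hyp_iff)
  then have "0 < lor K (swap_origin K p x) (swap_origin K p x)"
    using assms p K by (simp add: hyp_iff lor_swap_origin)
  then show ?thesis
    using assms p K swap_origin_subspace[OF subspace_coord_space] by (simp add: hyp_iff)
qed

lemma swap_origin_involutive:
  assumes "x \<in> hyp K d"
  shows "swap_origin K p (swap_origin K p x) = x"
proof -
  define s where "s = sqrt (lor K p p)"
  have pos: "0 < lor K x p" "0 < s" using assms p K lor_pos by (simp_all add: hyp_iff s_def)
  have s2: "s * s = lor K p p" using p K by (simp add: s_def hyp_iff flip: power2_eq_square)
  define a where "a = lor K x p"
  define c where "c = (a - s) / (1 - s)"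
  have "lor K (swap_origin K p x) p = s * s / a"
    using lor_swap_origin[of K p x 0] p K pos by (simp add: hyp_iff s2 a_def)
  moreover have form: "swap_origin K p z
      = (1 / lor K z p) *\<^sub>R (s *\<^sub>R z + ((lor K z p - s) / (1 - s)) *\<^sub>R p)" for z
    by (simp add: swap_origin_def Let_def s_def)
  moreover have "swap_origin K p x = (1 / a) *\<^sub>R (s *\<^sub>R x + c *\<^sub>R p)"
    by (simp add: form[of x] a_def c_def)
  ultimately have "swap_origin K p (swap_origin K p x)
      = (1 / (s * s / a)) *\<^sub>R (s *\<^sub>R ((1 / a) *\<^sub>R (s *\<^sub>R x + c *\<^sub>R p)) + ((s * s / a - s) / (1 - s)) *\<^sub>R p)"
    by (subst form[of "swap_origin K p x"]) (simp only:)
  also have "(s * s / a - s) / (1 - s) = - (s / a) * c"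
  proof -
    have "s * s / a - s = - (s / a) * (a - s)" using pos by (simp add: a_def field_simps)
    then show ?thesis by (simp add: c_def)
  qed
  also have "s *\<^sub>R ((1 / a) *\<^sub>R (s *\<^sub>R x + c *\<^sub>R p)) + (- (s / a) * c) *\<^sub>R p = (s * s / a) *\<^sub>R x"
    by (simp add: scaleR_add_right)
  finally show ?thesis using pos by (simp add: a_def)
qed

lemma hyp_dist_swap_origin:
  assumes "x \<in> hyp K d" "y \<in> hyp K d"
  shows "hyp_dist K (swap_origin K p x) (swap_origin K p y) = hyp_dist K x y"
proof -
  define c where "c = lor K p p / (lor K x p * lor K y p)"
  have pos: "0 < lor K x p" "0 < lor K y p" "0 < lor K p p" "0 < lor K x x" "0 < lor K y y"
    using assms p K lor_pos by (simp_all add: hyp_iff)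
  then have c: "0 < c" by (simp add: c_def)
  let ?f = "swap_origin K p"
  have eq: "lor K (?f x) (?f x) * lor K (?f y) (?f y) = c\<^sup>2 * (lor K x x * lor K y y)"
      "lor K (?f x) (?f y) = c * lor K x y"
    using pos by (simp_all add: lor_swap_origin[OF K] c_def power2_eq_square mult_ac)
  then have "lor K (?f x) (?f y) / sqrt (lor K (?f x) (?f x) * lor K (?f y) (?f y))
      = lor K x y / sqrt (lor K x x * lor K y y)"
    using c by (simp add: real_sqrt_mult)
  then show ?thesis
    using swap_origin_in_hyp assms K by (simp add: hyp_dist_eq hyp_iff)
qed

end

lemma cosh_hyp_dist_origin:
  assumes "K < 0" "0 < lor K x x"
  shows "cosh (sqrt (- K) * hyp_dist K x 0) = 1 / sqrt (lor K x x)"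
  using cosh_hyp_dist[of K x 0] assms by simp

lemma sinh_hyp_dist_origin:
  assumes "K < 0" "0 < lor K x x"
  shows "sinh (sqrt (- K) * hyp_dist K x 0) = sqrt (- K) * sqrt (ip x x) / sqrt (lor K x x)"
proof (rule power2_eq_imp_eq)
  have "(sinh (sqrt (- K) * hyp_dist K x 0))\<^sup>2 = 1 / lor K x x - 1"
    using assms by (simp add: sinh_square_eq cosh_hyp_dist_origin power_divide)
  also have "\<dots> = - K * ip x x / lor K x x"
  proof -
    have "1 - lor K x x = - K * ip x x" by (simp add: lor_def)
    then show ?thesis using assms by (metis diff_divide_distrib divide_self less_irrefl)
  qed
  finally show "(sinh (sqrt (- K) * hyp_dist K x 0))\<^sup>2
      = (sqrt (- K) * sqrt (ip x x) / sqrt (lor K x x))\<^sup>2"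
    using assms by (simp add: power_divide power_mult_distrib)
qed (use assms in auto)

text \<open>
  With the origin as middle point, the addition theorem for \<open>cosh\<close> turns the triangle inequality into
  the Cauchy-Schwarz inequality for \<open>x\<close> and \<open>y\<close>.
\<close>

lemma hyp_dist_triangle_origin:
  assumes K: "K < 0" and x: "0 < lor K x x" and y: "0 < lor K y y"
  shows "hyp_dist K x y \<le> hyp_dist K x 0 + hyp_dist K 0 y"
proof -
  let ?k = "sqrt (- K)"
  have "- K * ip x y \<ge> K * (sqrt (ip x x) * sqrt (ip y y))"
    using mult_left_mono_neg[of "- ip x y" "sqrt (ip x x) * sqrt (ip y y)" K]
      abs_ip_le[of x y] K by (simp add: abs_le_iff)
  then have "lor K x y \<le> 1 + (- K) * (sqrt (ip x x) * sqrt (ip y y))"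
    by (simp add: lor_def)
  then have "lor K x y / sqrt (lor K x x * lor K y y)
      \<le> (1 + (- K) * (sqrt (ip x x) * sqrt (ip y y))) / sqrt (lor K x x * lor K y y)"
    using x y by (intro divide_right_mono) auto
  also have "\<dots> = cosh (?k * hyp_dist K x 0 + ?k * hyp_dist K 0 y)"
  proof -
    have "?k * a * (?k * b) = - K * (a * b)" for a b
      using K by (simp add: mult_ac flip: mult.assoc[of ?k ?k])
    then show ?thesis
      using K x y by (simp add: cosh_add cosh_hyp_dist_origin sinh_hyp_dist_origin
        hyp_dist_commute[of K 0 y] real_sqrt_mult add_divide_distrib diff_divide_distrib)
  qed
  finally have "cosh (?k * hyp_dist K x y) \<le> cosh (?k * (hyp_dist K x 0 + hyp_dist K 0 y))"
    using cosh_hyp_dist[OF assms] by (simp add: distrib_left)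
  then have "?k * hyp_dist K x y \<le> ?k * (hyp_dist K x 0 + hyp_dist K 0 y)"
    using K by (subst (asm) cosh_real_nonneg_le_iff) auto
  then show ?thesis using K by simp
qed

text \<open>
  The reflection exchanging \<open>y\<close> and the origin reduces this to the previous case.
\<close>

lemma hyp_dist_triangle:
  assumes K: "K < 0" and xyz: "x \<in> hyp K d" "y \<in> hyp K d" "z \<in> hyp K d"
  shows "hyp_dist K x z \<le> hyp_dist K x y + hyp_dist K y z"
proof -
  let ?f = "swap_origin K y"
  have f: "?f x \<in> hyp K d" "?f z \<in> hyp K d" "?f y = 0"
    using swap_origin_in_hyp[OF K xyz(2)] swap_origin_involutive[OF K xyz(2), of 0]
      swap_origin_0[OF K xyz(2)] K xyz by auto
  have "hyp_dist K (?f x) (?f z) \<le> hyp_dist K (?f x) (?f y) + hyp_dist K (?f y) (?f z)"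
    using hyp_dist_triangle_origin f K by (simp add: hyp_iff)
  then show ?thesis
    using hyp_dist_swap_origin[OF K xyz(2)] xyz by simp
qed

lemma Metric_space_hyp:
  assumes "K < 0"
  shows "Metric_space (hyp K d) (hyp_dist K)"
  using assms hyp_dist_triangle hyp_dist_eq_0_iff
  by unfold_locales (auto simp: hyp_dist_commute hyp_iff)

lemma openin_hyp_top_iff:
  assumes "K < 0"
  shows "openin (hyp_top K d) U \<longleftrightarrow>
    U \<subseteq> hyp K d \<and> (\<forall>x\<in>U. \<exists>r>0. \<forall>y\<in>hyp K d. hyp_dist K x y < r \<longrightarrow> y \<in> U)"
proof -
  interpret Metric_space "hyp K d" "hyp_dist K" by (rule Metric_space_hyp[OF assms])
  have "mball x r \<subseteq> U \<longleftrightarrow> (\<forall>y\<in>hyp K d. hyp_dist K x y < r \<longrightarrow> y \<in> U)"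
    if "x \<in> hyp K d" for x r
    using that by auto
  then show ?thesis
    unfolding hyp_top_def openin_mtopology by (meson subsetD)
qed

lemma topspace_hyp_top [simp]: "K < 0 \<Longrightarrow> topspace (hyp_top K d) = hyp K d"
  by (simp add: hyp_top_def Metric_space.topspace_mtopology[OF Metric_space_hyp])

text \<open>
  By \<open>euclid_le_sinh_hyp_dist\<close>, a linear functional varies by at most a multiple of \<open>sinh\<close> of the scaled
  radius on a small ball.
\<close>

lemma open_halfspace:
  assumes K: "K < 0"
  shows "openin (hyp_top K d) {x \<in> hyp K d. ip x e < c}"
  unfolding openin_hyp_top_iff[OF K]
proof (intro conjI ballI)
  fix x assume x: "x \<in> {x \<in> hyp K d. ip x e < c}"
  let ?k = "sqrt (- K)"
  have "((\<lambda>r. sinh (?k * r) / ?k * sqrt (ip e e)) \<longlongrightarrow> sinh (?k * 0) / ?k * sqrt (ip e e)) (at_right 0)"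
    using K by (intro tendsto_intros) auto
  moreover have "sinh (?k * 0) / ?k * sqrt (ip e e) < c - ip x e" using x by simp
  ultimately have "eventually (\<lambda>r. sinh (?k * r) / ?k * sqrt (ip e e) < c - ip x e) (at_right 0)"
    by (rule order_tendstoD(2))
  then obtain b where b: "b > 0" "\<And>r. 0 < r \<Longrightarrow> r < b \<Longrightarrow> sinh (?k * r) / ?k * sqrt (ip e e) < c - ip x e"
    by (auto simp: eventually_at_right_field)
  define r where "r = b / 2"
  have "r > 0" "r < b" using b(1) by (simp_all add: r_def)
  then have r: "r > 0" "sinh (?k * r) / ?k * sqrt (ip e e) < c - ip x e"
    using b(2) by blast+
  have "ip y e < c" if y: "y \<in> hyp K d" "hyp_dist K x y < r" for y
  proof -
    have "- K * ip (y - x) (y - x) \<le> (sinh (?k * hyp_dist K y x))\<^sup>2"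
      using x y K by (intro euclid_le_sinh_hyp_dist) (auto simp: hyp_iff)
    also have "\<dots> \<le> (sinh (?k * r))\<^sup>2"
      using y K by (intro power_mono) (auto simp: hyp_dist_commute)
    finally have "ip (y - x) (y - x) \<le> (sinh (?k * r))\<^sup>2 / (?k)\<^sup>2"
      using K by (simp add: field_simps)
    then have "ip (y - x) (y - x) \<le> (sinh (?k * r) / ?k)\<^sup>2"
      by (simp add: power_divide)
    then have "sqrt (ip (y - x) (y - x)) \<le> sinh (?k * r) / ?k"
      using r K by (intro real_le_lsqrt) auto
    then have "sqrt (ip (y - x) (y - x)) * sqrt (ip e e) \<le> sinh (?k * r) / ?k * sqrt (ip e e)"
      by (rule mult_right_mono) simp
    then have "ip (y - x) e < c - ip x e"
      using abs_ip_le[of "y - x" e] r by linarith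
    then show ?thesis by (simp add: ip_diff_left)
  qed
  then show "\<exists>r>0. \<forall>y\<in>hyp K d. hyp_dist K x y < r \<longrightarrow> y \<in> {x \<in> hyp K d. ip x e < c}"
    using r(1) by blast
qed auto

lemma open_halfspace_greater:
  assumes "K < 0"
  shows "openin (hyp_top K d) {x \<in> hyp K d. c < ip x e}"
  using open_halfspace[OF assms, of d "- e" "- c"] by (simp add: ip_minus_right)

section \<open>Flats\<close>

lemma flats_iff:
  assumes K: "K < 0"
  shows "E \<in> flats K d k \<longleftrightarrow> (\<exists>a V. a \<in> hyp K d \<and> subspace V \<and> V \<subseteq> coord_space d \<and> dim V = k \<and>
    E = {x \<in> hyp K d. x - a \<in> V})"
proof
  assume "E \<in> flats K d k"
  then obtain A where A: "E = A \<inter> hyp K d" "affine A" "A \<subseteq> coord_space d"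
    "dim {x - y | x y. x \<in> A \<and> y \<in> A} = k" "A \<inter> hyp K d \<noteq> {}"
    unfolding flats_def by blast
  then obtain a where a: "a \<in> A" "a \<in> hyp K d" by blast
  define V where "V = {x - y | x y. x \<in> A \<and> y \<in> A}"
  have V0: "V = {- a + x | x. x \<in> A}" and sub: "subspace {- a + x | x. x \<in> A}"
  proof -
    show sub: "subspace {- a + x | x. x \<in> A}" 
      using affine_diffs_subspace[OF A(2) a(1)] by (simp add: Setcompr_eq_image)
    have "x - y \<in> {- a + x | x. x \<in> A}" if "x \<in> A" "y \<in> A" for x y
      using subspace_diff[OF sub, of "- a + x" "- a + y"] that by auto
    then show "V = {- a + x | x. x \<in> A}"
      unfolding V_def using a(1) by force
  qed
  have "x \<in> A \<longleftrightarrow> x - a \<in> V" for x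
    unfolding V0 by (auto simp: algebra_simps)
  then have "E = {x \<in> hyp K d. x - a \<in> V}" using A(1) by auto
  moreover have "V \<subseteq> coord_space d"
    using A(3) by (auto simp: V_def intro!: subspace_diff[OF subspace_coord_space])
  moreover have "subspace V" "dim V = k" using V0 sub A(4) by (auto simp: V_def)
  ultimately show "\<exists>a V. a \<in> hyp K d \<and> subspace V \<and> V \<subseteq> coord_space d \<and> dim V = k \<and>
    E = {x \<in> hyp K d. x - a \<in> V}" using a(2) by blast
next
  assume "\<exists>a V. a \<in> hyp K d \<and> subspace V \<and> V \<subseteq> coord_space d \<and> dim V = k \<and>
    E = {x \<in> hyp K d. x - a \<in> V}"
  then obtain a V where V: "a \<in> hyp K d" "subspace V" "V \<subseteq> coord_space d" "dim V = k"
    "E = {x \<in> hyp K d. x - a \<in> V}" by blast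
  define A where "A = (+) a ` V"
  have A: "x \<in> A \<longleftrightarrow> x - a \<in> V" for x
    by (auto simp: A_def image_iff intro!: bexI[of _ "x - a"])
  have "affine A" unfolding A_def using V(2) subspace_imp_affine affine_translation by blast
  moreover have "A \<subseteq> coord_space d"
    using V(1,3) subspace_add[OF subspace_coord_space] K by (auto simp: A_def hyp_iff)
  moreover have "{x - y | x y. x \<in> A \<and> y \<in> A} = V"
  proof
    show "{x - y | x y. x \<in> A \<and> y \<in> A} \<subseteq> V"
      by (auto simp: A_def subspace_diff[OF V(2)])
    show "V \<subseteq> {x - y | x y. x \<in> A \<and> y \<in> A}"
    proof
      fix v assume "v \<in> V"
      then have "v = (a + v) - a" "a + v \<in> A" "a \<in> A"
        using subspace_0[OF V(2)] by (auto simp: A)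
      then show "v \<in> {x - y | x y. x \<in> A \<and> y \<in> A}" by blast
    qed
  qed
  moreover have "E = A \<inter> hyp K d" using V(5) A by auto
  moreover have "a \<in> A" using subspace_0[OF V(2)] by (simp add: A)
  ultimately show "E \<in> flats K d k" using V(1,4) unfolding flats_def by blast
qed

lemma flats0_iff:
  assumes K: "K < 0"
  shows "L \<in> flats0 K d k \<longleftrightarrow>
    (\<exists>V. subspace V \<and> V \<subseteq> coord_space d \<and> dim V = k \<and> L = V \<inter> hyp K d)"
proof
  assume "L \<in> flats0 K d k"
  then obtain a V where V: "subspace V" "V \<subseteq> coord_space d" "dim V = k" "0 \<in> L"
    "L = {x \<in> hyp K d. x - a \<in> V}"
    unfolding flats0_def using flats_iff[OF K] by auto
  then have a: "- a \<in> V" by simp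
  have "x - a \<in> V \<longleftrightarrow> x \<in> V" for x
    using subspace_diff[OF V(1) _ a, of "x - a"] subspace_add[OF V(1) _ a, of x] by auto
  then have "L = V \<inter> hyp K d" using V(5) by auto
  then show "\<exists>V. subspace V \<and> V \<subseteq> coord_space d \<and> dim V = k \<and> L = V \<inter> hyp K d"
    using V by blast
next
  assume "\<exists>V. subspace V \<and> V \<subseteq> coord_space d \<and> dim V = k \<and> L = V \<inter> hyp K d"
  then obtain V where V: "subspace V" "V \<subseteq> coord_space d" "dim V = k" "L = V \<inter> hyp K d" by blast
  then have "L = {x \<in> hyp K d. x - 0 \<in> V}" by auto
  then have "L \<in> flats K d k" using V zero_in_hyp[OF K] flats_iff[OF K] by blast
  then show "L \<in> flats0 K d k" using V subspace_0 K by (simp add: flats0_def)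
qed

text \<open>
  By \<open>orth_compl_orth_compl\<close>, a flat is an intersection of hyperplanes.
\<close>

lemma closedin_flat:
  assumes K: "K < 0" and E: "E \<in> flats K d k"
  shows "closedin (hyp_top K d) E"
proof -
  obtain a V where V: "a \<in> hyp K d" "subspace V" "V \<subseteq> coord_space d"
    "E = {x \<in> hyp K d. x - a \<in> V}"
    using E flats_iff[OF K] by blast
  let ?W = "orth_compl d V"
  let ?U = "\<lambda>w. {x \<in> hyp K d. ip x w < ip a w} \<union> {x \<in> hyp K d. ip a w < ip x w}"
  have "x \<in> E \<longleftrightarrow> x \<notin> (\<Union>w\<in>?W. ?U w)" if "x \<in> hyp K d" for x
  proof -
    have "x - a \<in> coord_space d"
      using that V(1) K subspace_diff[OF subspace_coord_space] by (simp add: hyp_iff)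
    then have "x - a \<in> V \<longleftrightarrow> (\<forall>w\<in>?W. ip (x - a) w = 0)"
      using orth_compl_orth_compl[OF V(2,3)] by (auto simp: orth_compl_def)
    then show ?thesis using that V(4) by (auto simp: ip_diff_left not_less intro: antisym)
  qed
  then have "hyp K d - E = (\<Union>w\<in>?W. ?U w)" by auto
  moreover have "openin (hyp_top K d) (\<Union>w\<in>?W. ?U w)"
    using open_halfspace[OF K] open_halfspace_greater[OF K] by blast
  ultimately show ?thesis using V(4) K by (auto simp: closedin_def)
qed

text \<open>
  The generators of the Fell topology speak of closed sets, and flats are closed.
\<close>

lemma flat_opens_hitting:
  assumes K: "K < 0" and U: "openin (hyp_top K d) U" and S: "S \<subseteq> flats K d k"
  shows "{E \<in> S. E \<inter> U \<noteq> {}} \<in> flat_opens K d S"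
proof -
  let ?H = "{F. closedin (hyp_top K d) F \<and> F \<inter> U \<noteq> {}}"
  have "openin (fell_topology (hyp_top K d)) ?H"
    unfolding fell_topology_def using U by (intro topology_generated_by_Basis) blast
  moreover have "{E \<in> S. E \<inter> U \<noteq> {}} = ?H \<inter> S"
    using closedin_flat[OF K] S by blast
  ultimately show ?thesis by (auto simp: flat_opens_def openin_subtopology)
qed

lemma flat_opens_Pow: "flat_opens K d S \<subseteq> Pow S"
  by (auto simp: flat_opens_def openin_subtopology)

lemma space_flats_borel [simp]: "space (flats_borel K d k) = flats K d k"
  and space_flats0_borel [simp]: "space (flats0_borel K d k) = flats0 K d k"
  by (simp_all add: flats_borel_def flats0_borel_def flat_opens_Pow)

lemma sets_flats_borel: "sets (flats_borel K d k) = sigma_sets (flats K d k) (flat_opens K d (flats K d k))"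
  and sets_flats0_borel: "sets (flats0_borel K d k) = sigma_sets (flats0 K d k) (flat_opens K d (flats0 K d k))"
  by (simp_all add: flats_borel_def flats0_borel_def flat_opens_Pow)

lemma flats_borel_hitting:
  assumes "K < 0" "openin (hyp_top K d) U"
  shows "{E \<in> flats K d k. E \<inter> U \<noteq> {}} \<in> sets (flats_borel K d k)"
  unfolding sets_flats_borel using flat_opens_hitting[OF assms] by blast

lemma flats0_borel_hitting:
  assumes "K < 0" "openin (hyp_top K d) U"
  shows "{L \<in> flats0 K d k. L \<inter> U \<noteq> {}} \<in> sets (flats0_borel K d k)"
  unfolding sets_flats0_borel
  using flat_opens_hitting[OF assms, of "flats0 K d k" k] by (auto simp: flats0_def)

lemma orthogonal_slice_flat:
  assumes K: "K < 0" and V: "subspace V" "V \<subseteq> coord_space d" and x: "x \<in> hyp K d"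
  shows "{y \<in> hyp K d. y - x \<in> orth_compl d V} \<in> flats K d (d - dim V)"
  unfolding flats_iff[OF K]
  by (intro exI[of _ x] exI[of _ "orth_compl d V"] conjI refl x subspace_orth_compl
      orth_compl_subset dim_orth_compl[OF V])

text \<open>
  At points of a flat \<open>L\<close> through the origin, being orthogonal to \<open>L\<close> for the Riemannian metric means
  the same as for the Euclidean one, because the correction term of the tensor contains the product
  with the position vector, which lies in \<open>L\<close>.  Uniqueness then follows by comparing dimensions.
\<close>

lemma orth_flat_eq:
  assumes K: "K < 0" and V: "subspace V" "V \<subseteq> coord_space d" "dim V = m"
    and x: "x \<in> V" "x \<in> hyp K d"
  shows "orth_flat K d (d - m) (V \<inter> hyp K d) x = {y \<in> hyp K d. y - x \<in> orth_compl d V}"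
  unfolding orth_flat_def
proof (rule the_equality, intro conjI)
  let ?W = "orth_compl d V" and ?L = "V \<inter> hyp K d"
  let ?E = "{y \<in> hyp K d. y - x \<in> ?W}"
  have dimW: "dim ?W = d - m" using dim_orth_compl[OF V(1,2)] V(3) by simp
  show "?E \<in> flats K d (d - m)"
    using orthogonal_slice_flat[OF K V(1,2) x(2)] V(3) by simp
  show "x \<in> ?E" using x subspace_0[OF subspace_orth_compl] by simp
  show "orthogonal_at K x ?E ?L"
  proof -
    have "ip (y - x) (z - x) = 0" "ip x (y - x) = 0" if "y \<in> ?E" "z \<in> ?L" for y z
      using that x(1) subspace_diff[OF V(1)] by (auto simp: orth_compl_def ip_commute[of x "y - x"])
    then show ?thesis by (simp add: orthogonal_at_def hyp_tensor_def)
  qed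
  have pos: "0 < lor K x x" using x K by (simp add: hyp_iff)
  fix E assume "E \<in> flats K d (d - m) \<and> x \<in> E \<and> orthogonal_at K x E ?L"
  then have E: "E \<in> flats K d (d - m)" "x \<in> E"
    and orth: "\<And>y z. y \<in> E \<Longrightarrow> z \<in> V \<Longrightarrow> z \<in> hyp K d \<Longrightarrow> hyp_tensor K x (y - x) (z - x) = 0"
    by (auto simp: orthogonal_at_def)
  have tensor: "hyp_tensor K x v w = ip v w / lor K x x - K * ip x v * ip x w / (lor K x x)\<^sup>2" for v w
    by (simp add: hyp_tensor_def lor_def)
  \<comment> \<open>orthogonality is given for points of the ball only; the ball is open, so that this determines
    it for all vectors of a subspace\<close>
  have small: "\<exists>t>0. y + t *\<^sub>R v \<in> hyp K d" if "y \<in> hyp K d" "v \<in> coord_space d" for y v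
  proof -
    have "((\<lambda>t. lor K y y + 2 * K * t * ip y v + K * t * t * ip v v) \<longlongrightarrow>
        lor K y y + 2 * K * 0 * ip y v + K * 0 * 0 * ip v v) (at_right 0)"
      by (intro tendsto_intros)
    moreover have "lor K (y + t *\<^sub>R v) (y + t *\<^sub>R v)
        = lor K y y + 2 * K * t * ip y v + K * t * t * ip v v" for t
      by (simp add: lor_def ip_linear ip_commute[of v y] algebra_simps)
    ultimately have "((\<lambda>t. lor K (y + t *\<^sub>R v) (y + t *\<^sub>R v)) \<longlongrightarrow> lor K y y) (at_right 0)"
      by simp
    then have "eventually (\<lambda>t. 0 < lor K (y + t *\<^sub>R v) (y + t *\<^sub>R v)) (at_right 0)"
      using that(1) K by (intro order_tendstoD(1)) (auto simp: hyp_iff)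
    then obtain b where "b > 0" "\<And>t. 0 < t \<Longrightarrow> t < b \<Longrightarrow> 0 < lor K (y + t *\<^sub>R v) (y + t *\<^sub>R v)"
      by (auto simp: eventually_at_right_field)
    then have "0 < b / 2 \<and> 0 < lor K (y + (b / 2) *\<^sub>R v) (y + (b / 2) *\<^sub>R v)" by simp
    moreover have "y + (b / 2) *\<^sub>R v \<in> coord_space d"
      using that K subspace_add[OF subspace_coord_space] subspace_scale[OF subspace_coord_space]
      by (simp add: hyp_iff)
    ultimately show ?thesis using K by (intro exI[of _ "b / 2"]) (simp add: hyp_iff)
  qed
  have perp: "y - x \<in> ?W" if y: "y \<in> E" for y
  proof -
    define v where "v = y - x"
    have yh: "y \<in> hyp K d" using E(1) y by (auto simp: flats_iff[OF K])
    \<comment> \<open>testing with the origin as a point of \<open>L\<close> removes the correction term\<close>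
    have vx: "ip v x = 0"
    proof -
      have "hyp_tensor K x v (0 - x) = 0"
        using orth[OF y, of 0] V(1) K by (simp add: subspace_0 v_def)
      then have "ip v x / lor K x x = K * ip v x * ip x x / (lor K x x)\<^sup>2"
        by (simp add: tensor ip_minus_right ip_commute[of x v])
      then have "ip v x * lor K x x = ip v x * (K * ip x x)"
        using pos by (simp add: field_simps power2_eq_square)
      then have "ip v x * (lor K x x - K * ip x x) = 0" by (simp add: right_diff_distrib)
      then show ?thesis by (simp add: lor_def)
    qed
    have "ip v z = 0" if z: "z \<in> V" for z
    proof -
      obtain t where t: "t > 0" "0 + t *\<^sub>R z \<in> hyp K d"
        using small[of 0 z] z V(2) K by auto
      then have "hyp_tensor K x v (t *\<^sub>R z - x) = 0"
        using orth[OF y, of "t *\<^sub>R z"] subspace_scale[OF V(1) z] by (simp add: v_def)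
      then show ?thesis
        using vx pos t(1) by (simp add: tensor ip_commute[of x v] ip_linear)
    qed
    moreover have "v \<in> coord_space d"
      using yh x(2) K subspace_diff[OF subspace_coord_space] by (simp add: v_def hyp_iff)
    ultimately show ?thesis by (auto simp: orth_compl_def v_def)
  qed
  obtain a D where D: "subspace D" "D \<subseteq> coord_space d" "dim D = d - m"
    "E = {y \<in> hyp K d. y - a \<in> D}"
    using E(1) flats_iff[OF K] by auto
  have xa: "x - a \<in> D" using E(2) D(4) by simp
  have "D \<subseteq> ?W"
  proof
    fix v assume v: "v \<in> D"
    obtain t where t: "t > 0" "x + t *\<^sub>R v \<in> hyp K d"
      using small[OF x(2)] v D(2) by blast
    then have "x + t *\<^sub>R v \<in> E"
      using D(4) subspace_add[OF D(1) xa subspace_scale[OF D(1) v, of t]]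
      by (simp add: algebra_simps)
    from perp[OF this] have "t *\<^sub>R v \<in> ?W" by simp
    from subspace_scale[OF subspace_orth_compl this, of "1 / t"] show "v \<in> ?W" using t by simp
  qed
  then have "D = ?W"
    using subspace_eq_if_dim_eq[OF D(1) subspace_orth_compl] orth_compl_subset D(3) dimW by metis
  moreover have "y - a \<in> D \<longleftrightarrow> y - x \<in> D" for y
    using subspace_diff[OF D(1) _ xa, of "y - a"] subspace_add[OF D(1) _ xa, of "y - x"] by auto
  ultimately show "E = ?E" using D(4) by auto
qed

section \<open>Random flats through the origin\<close>

definition householder :: "point \<Rightarrow> point \<Rightarrow> point" where
  "householder n x = x - (2 * ip x n / ip n n) *\<^sub>R n"

lemma ip_householder: "ip (householder n x) (householder n y) = ip x y"
proof (cases "n = 0")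
  case False
  define a b where "a = 2 * ip x n / ip n n" and "b = 2 * ip y n / ip n n"
  have a: "a * ip n n = 2 * ip x n" and b: "b * ip n n = 2 * ip y n"
    using False by (simp_all add: a_def b_def)
  have "ip (householder n x) (householder n y)
      = ip x y - b * ip x n - a * ip y n + a * (b * ip n n)"
  proof -
    have "householder n x = x - a *\<^sub>R n" "householder n y = y - b *\<^sub>R n"
      by (simp_all add: householder_def a_def b_def)
    then show ?thesis by (simp only:) (simp add: ip_linear ip_commute[of n y] algebra_simps)
  qed
  moreover have "b * (2 * ip x n) = a * (2 * ip y n)"
    unfolding a[symmetric] b[symmetric] by simp
  moreover have "a * (b * ip n n) = a * (2 * ip y n)" by (simp only: b)
  ultimately show ?thesis by linarith
qed (simp add: householder_def)

lemma householder_involutive: "householder n (householder n x) = x"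
  by (cases "n = 0") (auto simp: householder_def ip_linear simp flip: scaleR_add_left scaleR_diff_left)

lemma linear_householder: "linear (householder n)"
  by (rule linearI)
    (auto simp: householder_def ip_linear scaleR_add_left add_divide_distrib distrib_left scaleR_diff_right)

text \<open>
  The reflection in the bisecting hyperplane exchanges vectors of equal length; this makes the
  isometries fixing the origin transitive on directions.
\<close>

lemma householder_diff:
  assumes "ip e e = ip e' e'"
  shows "householder (e - e') e = e'"
proof (cases "e = e'")
  case False
  have "ip (e - e') (e - e') = 2 * ip e (e - e')"
    using assms by (simp add: ip_linear ip_commute[of e' e])
  moreover have "ip (e - e') (e - e') \<noteq> 0" using False by simp
  ultimately show ?thesis by (simp add: householder_def)
qed (simp add: householder_def)

context
  fixes K :: real and d :: nat and n :: point
  assumes K: "K < 0" and n: "n \<in> coord_space d"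
begin

lemma householder_coord_space: "x \<in> coord_space d \<Longrightarrow> householder n x \<in> coord_space d"
  using n subspace_coord_space[of d] by (simp add: householder_def subspace_diff subspace_scale)

lemma householder_hyp: "householder n x \<in> hyp K d \<longleftrightarrow> x \<in> hyp K d"
  using householder_coord_space[of x] householder_coord_space[of "householder n x"] K
  by (auto simp: hyp_iff lor_def ip_householder householder_involutive)

lemma householder_isometry: "householder n \<in> isometries_fixing_origin K d"
proof -
  have "bij_betw (householder n) (hyp K d) (hyp K d)"
    by (rule bij_betw_byWitness[where f' = "householder n"])
      (auto simp: householder_hyp householder_involutive)
  moreover have "householder n 0 = 0" by (simp add: householder_def)
  ultimately show ?thesis
    by (simp add: isometries_fixing_origin_def hyp_dist_def ip_householder)
qed

lemma householder_flats0:
  assumes "L \<in> flats0 K d k"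
  shows "householder n ` L \<in> flats0 K d k"
proof -
  obtain V where V: "subspace V" "V \<subseteq> coord_space d" "dim V = k" "L = V \<inter> hyp K d"
    using assms flats0_iff[OF K] by auto
  let ?g = "householder n"
  obtain C where C: "orthonormal C" "span C = V" "card C = k"
    using orthonormal_basis_exists[OF V(1,2)] V(3) by metis
  have inj: "inj ?g" by (metis householder_involutive injI)
  have "orthonormal (?g ` C)"
    using C(1) inj by (auto simp: orthonormal_def ip_householder inj_eq)
  moreover have "span (?g ` C) = ?g ` V"
    using linear_span_image[OF linear_householder] C(2) by metis
  moreover have "card (?g ` C) = k"
    using C(3) inj by (simp add: card_image inj_on_subset)
  ultimately have "dim (?g ` V) = k" using orthonormal_card by metis
  moreover have "subspace (?g ` V)" by (rule linear_subspace_image[OF linear_householder V(1)])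
  moreover have "?g ` V \<subseteq> coord_space d" using V(2) householder_coord_space by auto
  moreover have "?g ` L = ?g ` V \<inter> hyp K d"
    using V(4) householder_hyp by auto
  ultimately show ?thesis using flats0_iff[OF K] by blast
qed

end

definition reaching_flats :: "real \<Rightarrow> nat \<Rightarrow> nat \<Rightarrow> real \<Rightarrow> point \<Rightarrow> point set set" where
  "reaching_flats K d k c e = {L \<in> flats0 K d k. \<exists>y\<in>L. c < ip y e}"

lemma reaching_flats_measurable:
  assumes K: "K < 0"
  shows "reaching_flats K d k c e \<in> sets (flats0_borel K d k)"
proof -
  have "reaching_flats K d k c e = {L \<in> flats0 K d k. L \<inter> {x \<in> hyp K d. c < ip x e} \<noteq> {}}"
    by (auto simp: reaching_flats_def flats0_iff[OF K])
  then show ?thesis using flats0_borel_hitting[OF K open_halfspace_greater[OF K]] by simp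
qed

lemma reaching_flats_invariant:
  assumes K: "K < 0" and \<nu>: "invariant_probability K d k \<nu>"
    and e: "e \<in> coord_space d" "e' \<in> coord_space d" "ip e e = ip e' e'"
  shows "emeasure \<nu> (reaching_flats K d k c e) = emeasure \<nu> (reaching_flats K d k c e')"
proof -
  define g where "g = householder (e - e')"
  have n: "e - e' \<in> coord_space d" using e subspace_diff[OF subspace_coord_space] by blast
  have "ip (g y) e' = ip y e" for y
    using ip_householder[of "e - e'" y e] householder_diff[OF e(3)] by (simp add: g_def)
  moreover have "g ` L \<in> flats0 K d k" if "L \<in> flats0 K d k" for L
    using householder_flats0[OF K n that] by (simp add: g_def)
  ultimately have "{L \<in> flats0 K d k. g ` L \<in> reaching_flats K d k c e'} = reaching_flats K d k c e"
    by (auto simp: reaching_flats_def)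
  moreover have "reaching_flats K d k c e' \<in> sets \<nu>"
    using reaching_flats_measurable[OF K] \<nu> by (simp add: invariant_probability_def)
  moreover have "\<forall>g\<in>isometries_fixing_origin K d. \<forall>B\<in>sets \<nu>.
      emeasure \<nu> {L \<in> flats0 K d k. g ` L \<in> B} = emeasure \<nu> B"
    using \<nu> by (simp add: invariant_probability_def)
  moreover have "g \<in> isometries_fixing_origin K d"
    unfolding g_def by (rule householder_isometry[OF K n])
  ultimately show ?thesis by fastforce
qed

lemma sum_coords_le:
  assumes "orthonormal C" "C \<subseteq> coord_space d"
  shows "(\<Sum>i<d. \<Sum>c\<in>C. (coord c i)\<^sup>2) = card C"
proof -
  have "(\<Sum>i<d. (coord c i)\<^sup>2) = 1" if "c \<in> C" for c
    using that assms ip_eq_sum[of "{..<d}" c c]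
    by (auto simp: power2_eq_square orthonormalD(2) coord_space_def)
  then have "(\<Sum>c\<in>C. \<Sum>i<d. (coord c i)\<^sup>2) = card C" by simp
  then show ?thesis by (subst sum.swap)
qed

text \<open>
  Each reached axis contributes at least a fixed amount to the sum of the squared coordinates of an
  orthonormal basis of the subspace, and that sum is \<open>q\<close>.
\<close>

lemma card_reached_axes_le:
  fixes c :: real
  assumes K: "K < 0" and c: "c > 0" and L: "L \<in> flats0 K d q"
  shows "card {i. i < d \<and> L \<in> reaching_flats K d q c (r *\<^sub>R unit_vec i)} * c\<^sup>2 \<le> q * r\<^sup>2 / - K"
proof -
  obtain V where V: "subspace V" "V \<subseteq> coord_space d" "dim V = q" "L = V \<inter> hyp K d"
    using L flats0_iff[OF K] by auto
  obtain C where C: "orthonormal C" "span C = V" "card C = q"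
    using orthonormal_basis_exists[OF V(1,2)] V(3) by metis
  define S where "S = {i. i < d \<and> L \<in> reaching_flats K d q c (r *\<^sub>R unit_vec i)}"
  have "c\<^sup>2 \<le> r\<^sup>2 / - K * (\<Sum>b\<in>C. (coord b i)\<^sup>2)" if "i \<in> S" for i
  proof -
    have "L \<in> reaching_flats K d q c (r *\<^sub>R unit_vec i)" using that by (simp add: S_def)
    then obtain y where y: "y \<in> L" "c < r * coord y i"
      by (auto simp: reaching_flats_def ip_scaleR_right)
    have yV: "y \<in> span C" using y V C by simp
    have "coord y i = ip (unit_vec i) (\<Sum>b\<in>C. ip y b *\<^sub>R b)"
      using orthonormal_expansion[OF C(1) yV] by simp
    then have "coord y i = (\<Sum>b\<in>C. ip y b * coord b i)"
      by (simp add: ip_sum_right ip_scaleR_right)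
    then have "(coord y i)\<^sup>2 \<le> (\<Sum>b\<in>C. (ip y b)\<^sup>2) * (\<Sum>b\<in>C. (coord b i)\<^sup>2)"
      using Cauchy_Schwarz_ineq_sum by simp
    also have "\<dots> = ip y y * (\<Sum>b\<in>C. (coord b i)\<^sup>2)"
      using orthonormal_Parseval[OF C(1) yV] by simp
    also have "\<dots> \<le> 1 / - K * (\<Sum>b\<in>C. (coord b i)\<^sup>2)"
    proof (rule mult_right_mono)
      have "0 < lor K y y" using y V K by (simp add: hyp_iff)
      then have "ip y y * - K \<le> 1" by (simp add: lor_def mult.commute)
      then show "ip y y \<le> 1 / - K" using K by (subst pos_le_divide_eq) auto
    qed (simp add: sum_nonneg)
    finally have *: "(coord y i)\<^sup>2 \<le> 1 / - K * (\<Sum>b\<in>C. (coord b i)\<^sup>2)" .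
    have "c\<^sup>2 \<le> (r * coord y i)\<^sup>2" using y c by (intro power_mono) auto
    also have "\<dots> \<le> r\<^sup>2 * (1 / - K * (\<Sum>b\<in>C. (coord b i)\<^sup>2))"
      using mult_left_mono[OF *, of "r\<^sup>2"] by (simp add: power_mult_distrib)
    finally show ?thesis by simp
  qed
  then have "(\<Sum>i\<in>S. c\<^sup>2) \<le> (\<Sum>i\<in>S. r\<^sup>2 / - K * (\<Sum>b\<in>C. (coord b i)\<^sup>2))"
    by (rule sum_mono)
  also have "\<dots> \<le> (\<Sum>i<d. r\<^sup>2 / - K * (\<Sum>b\<in>C. (coord b i)\<^sup>2))"
  proof (rule sum_mono2)
    show "0 \<le> r\<^sup>2 / - K * (\<Sum>b\<in>C. (coord b i)\<^sup>2)" for i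
      using K by (intro mult_nonneg_nonneg sum_nonneg divide_nonneg_pos) auto
  qed (auto simp: S_def)
  also have "\<dots> = r\<^sup>2 / - K * (\<Sum>i<d. \<Sum>b\<in>C. (coord b i)\<^sup>2)"
    by (simp only: sum_distrib_left)
  also have "\<dots> = r\<^sup>2 / - K * q"
    using sum_coords_le[OF C(1), of d] C V(2) span_superset[of C] by auto
  finally show ?thesis by (simp add: S_def mult.commute)
qed

text \<open>
  By invariance \<open>e\<close> may be replaced by any of the \<open>d\<close> coordinate vectors scaled to the length of \<open>e\<close>;
  the average over them is bounded by the expected number of reached axes.
\<close>

lemma prob_reaching_flats_le:
  fixes c :: real
  assumes K: "K < 0" and \<nu>: "invariant_probability K d q \<nu>"
    and c: "c > 0" and e: "e \<in> coord_space d"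
  shows "d * measure \<nu> (reaching_flats K d q c e) * c\<^sup>2 \<le> q * ip e e / - K"
proof -
  interpret prob_space \<nu> using \<nu> by (simp add: invariant_probability_def)
  define r where "r = sqrt (ip e e)"
  define A where "A = (\<lambda>i. reaching_flats K d q c (r *\<^sub>R unit_vec i))"
  have space: "space \<nu> = flats0 K d q" using \<nu> by (simp add: invariant_probability_def)
  have meas [measurable]: "A i \<in> sets \<nu>" for i
    using reaching_flats_measurable[OF K] \<nu> by (simp add: A_def invariant_probability_def)
  have "measure \<nu> (reaching_flats K d q c e) = measure \<nu> (A i)" if "i < d" for i
  proof -
    have "r *\<^sub>R unit_vec i \<in> coord_space d" "ip e e = ip (r *\<^sub>R unit_vec i) (r *\<^sub>R unit_vec i)"
      using that by (auto simp: coord_space_iff lookup_single r_def ip_linear when_def)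
    then show ?thesis
      using reaching_flats_invariant[OF K \<nu> e] by (simp add: measure_def A_def)
  qed
  then have "(\<Sum>i<d. measure \<nu> (A i)) = (\<Sum>i<d. measure \<nu> (reaching_flats K d q c e))"
    by (intro sum.cong) auto
  then have "d * measure \<nu> (reaching_flats K d q c e) = (\<Sum>i<d. measure \<nu> (A i))" by simp
  also have "\<dots> = (\<integral>L. (\<Sum>i<d. indicator (A i) L) \<partial>\<nu>)"
    by (subst Bochner_Integration.integral_sum) (auto simp: emeasure_eq_measure)
  also have "\<dots> \<le> q * r\<^sup>2 / - K / c\<^sup>2"
  proof (rule integral_le_const)
    show "AE L in \<nu>. (\<Sum>i<d. indicator (A i) L) \<le> q * r\<^sup>2 / - K / c\<^sup>2"
    proof (rule AE_I2)
      fix L assume "L \<in> space \<nu>"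
      then have "card {i. i < d \<and> L \<in> A i} * c\<^sup>2 \<le> q * r\<^sup>2 / - K"
        using card_reached_axes_le[OF K c] space by (simp add: A_def)
      moreover have "(\<Sum>i<d. indicator (A i) L) = real (card {i. i < d \<and> L \<in> A i})"
      proof -
        have "{..<d} \<inter> {i. L \<in> A i} = {i. i < d \<and> L \<in> A i}" by auto
        then show ?thesis by (simp add: indicator_def sum.If_cases)
      qed
      ultimately show "(\<Sum>i<d. indicator (A i) L) \<le> q * r\<^sup>2 / - K / c\<^sup>2"
        using c by (simp only: pos_le_divide_eq zero_less_power)
    qed
  qed (auto intro!: Bochner_Integration.integrable_sum simp: emeasure_eq_measure)
  finally have "d * measure \<nu> (reaching_flats K d q c e) * c\<^sup>2 \<le> q * r\<^sup>2 / - K"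
    using c by (simp only: pos_le_divide_eq zero_less_power)
  then show ?thesis by (simp add: r_def)
qed

section \<open>Lower integrals, uniform distributions and independent events\<close>

text \<open>
  The integral of an arbitrary nonnegative function is its lower integral, which is homogeneous
  because multiples of simple functions are simple.  The integrands that define the measure on flats
  are treated as such functions.
\<close>

lemma nn_integral_cmult_le:
  assumes "0 < r"
  shows "(\<integral>\<^sup>+ x. ennreal r * f x \<partial>M) \<le> ennreal r * (\<integral>\<^sup>+ x. f x \<partial>M)"
  unfolding nn_integral_def[of M "\<lambda>x. ennreal r * f x"]
proof (rule SUP_least, clarify)
  fix g assume g: "simple_function M g" "g \<le> (\<lambda>x. ennreal r * f x)"
  define h where "h = (\<lambda>x. ennreal (1 / r) * g x)"
  have r: "ennreal r * ennreal (1 / r) = 1" "ennreal (1 / r) * ennreal r = 1"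
    using assms by (simp_all flip: ennreal_mult')
  have h: "simple_function M h" unfolding h_def using g(1) by auto
  have "h x \<le> f x" for x
  proof -
    have "h x \<le> ennreal (1 / r) * (ennreal r * f x)"
      unfolding h_def using g(2) by (intro mult_left_mono) (auto simp: le_fun_def)
    then show ?thesis by (simp add: r flip: mult.assoc)
  qed
  then have "integral\<^sup>S M h \<le> integral\<^sup>N M f"
    unfolding nn_integral_def using h by (intro SUP_upper) (auto simp: le_fun_def)
  moreover have "integral\<^sup>S M g = ennreal r * integral\<^sup>S M h"
    unfolding h_def using g(1) by (simp add: r flip: mult.assoc)
  ultimately show "integral\<^sup>S M g \<le> ennreal r * integral\<^sup>N M f"
    by (simp add: mult_left_mono)
qed

text \<open>
  If \<open>A\<close> has measure \<open>0\<close> by the convention for sets outside the \<open>\<sigma>\<close>-algebra, then the density of the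
  uniform distribution takes the values \<open>0\<close> and \<open>\<infinity>\<close> only.  It equals its own half, and so its
  integral cannot be \<open>1\<close>.
\<close>

lemma prob_space_uniform_measureD:
  assumes "prob_space (uniform_measure M A)"
  shows "A \<in> sets M" "emeasure M A \<noteq> 0" "emeasure M A \<noteq> \<infinity>"
proof -
  have total: "emeasure (uniform_measure M A) (space M) = 1"
    using prob_space.emeasure_space_1[OF assms] by simp
  show A: "A \<in> sets M"
  proof (rule ccontr)
    assume "A \<notin> sets M"
    then have 0: "emeasure M A = 0" by (rule emeasure_notin_sets)
    define h where "h = (\<lambda>x. indicator A x / 0 * indicator (space M) x :: ennreal)"
    have "emeasure (uniform_measure M A) (space M) = 0 \<or>
        emeasure (uniform_measure M A) (space M) = integral\<^sup>N M h"
      unfolding uniform_measure_def density_def 0 h_def emeasure_measure_of_conv by simp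
    then have "integral\<^sup>N M h = 1" using total by auto
    moreover have "h = (\<lambda>x. ennreal (1 / 2) * h x)"
      by (auto simp: h_def fun_eq_iff indicator_def ennreal_mult_top)
    ultimately have "ennreal 1 \<le> ennreal (1 / 2) * ennreal 1"
      using nn_integral_cmult_le[of "1 / 2" M h] by simp
    then have "ennreal 1 \<le> ennreal (1 / 2)" by (simp only: ennreal_1 mult_1_right)
    then show False by (subst (asm) ennreal_le_iff) auto
  qed
  have "emeasure M A / emeasure M A = 1"
    using total emeasure_uniform_measure[OF A sets.top] sets.sets_into_space[OF A]
    by (simp add: Int_absorb2)
  then show "emeasure M A \<noteq> 0" "emeasure M A \<noteq> \<infinity>" by (auto simp: ennreal_divide_self)
qed

text \<open>
  The probability is the sum of the products of the probabilities of \<open>X \<in> C n\<close> and \<open>Y \<in> A n\<close>;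
  the second factors are at most \<open>\<delta>\<close>, and the first ones sum to at most \<open>1\<close>.
\<close>

lemma (in prob_space) prob_indep_disjoint_UN_le:
  fixes C A :: "nat \<Rightarrow> 'b set"
  assumes indep: "indep_var N X N' Y"
    and C: "\<And>n. C n \<in> sets N" "disjoint_family C" and A: "\<And>n. A n \<in> sets N'"
    and le: "\<And>n. prob (Y -` A n \<inter> space M) \<le> \<delta>"
  shows "{\<omega> \<in> space M. \<exists>n. X \<omega> \<in> C n \<and> Y \<omega> \<in> A n} \<in> events"
    and "prob {\<omega> \<in> space M. \<exists>n. X \<omega> \<in> C n \<and> Y \<omega> \<in> A n} \<le> \<delta>"
proof -
  have XY [measurable]: "X \<in> measurable M N" "Y \<in> measurable M N'"
    using indep by (auto simp: indep_var_eq)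
  define F where "F = (\<lambda>n. {\<omega> \<in> space M. X \<omega> \<in> C n \<and> Y \<omega> \<in> A n})"
  define G where "G = (\<lambda>n. X -` C n \<inter> space M)"
  have F: "F n \<in> events" and G: "G n \<in> events" for n
    using C(1) A unfolding F_def G_def by measurable
  have disj: "disjoint_family F" "disjoint_family G"
    using C(2) by (auto simp: disjoint_family_on_def F_def G_def)
  have eq: "{\<omega> \<in> space M. \<exists>n. X \<omega> \<in> C n \<and> Y \<omega> \<in> A n} = (\<Union>n. F n)"
    by (auto simp: F_def)
  show "{\<omega> \<in> space M. \<exists>n. X \<omega> \<in> C n \<and> Y \<omega> \<in> A n} \<in> events"
    unfolding eq using F by auto
  have "0 \<le> \<delta>" using le[of 0] measure_nonneg order_trans by blast
  have "prob (F n) \<le> \<delta> * prob (G n)" for n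
  proof -
    have "F n = (\<lambda>\<omega>. (X \<omega>, Y \<omega>)) -` (C n \<times> A n) \<inter> space M" by (auto simp: F_def)
    then have "prob (F n) = prob (G n) * prob (Y -` A n \<inter> space M)"
      using indep_varD[OF indep C(1) A] by (simp add: G_def)
    then show ?thesis using mult_left_mono[OF le[of n], of "prob (G n)"] by (simp add: mult.commute)
  qed
  moreover have "(\<lambda>n. prob (F n)) sums prob (\<Union>n. F n)"
    using F disj by (intro finite_measure_UNION) auto
  moreover have "(\<lambda>n. \<delta> * prob (G n)) sums (\<delta> * prob (\<Union>n. G n))"
    using G disj by (intro sums_mult finite_measure_UNION) auto
  ultimately have "prob (\<Union>n. F n) \<le> \<delta> * prob (\<Union>n. G n)"
    by (rule sums_le)
  also have "\<dots> \<le> \<delta>"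
    using \<open>0 \<le> \<delta>\<close> by (intro mult_left_le) auto
  finally show "prob {\<omega> \<in> space M. \<exists>n. X \<omega> \<in> C n \<and> Y \<omega> \<in> A n} \<le> \<delta>"
    by (simp only: eq)
qed

section \<open>Concentration of the distance to the origin\<close>

lemma hausdorff_outer_mono:
  "A \<subseteq> B \<Longrightarrow> hausdorff_outer X \<rho> m A \<le> hausdorff_outer X \<rho> m B"
  unfolding hausdorff_outer_def by (intro SUP_mono' INF_superset_mono) auto

text \<open>
  Since \<open>f\<close> is an isometric involution of the whole space, it transports covers of \<open>f ` A\<close> to covers of
  \<open>A\<close> by sets of the same diameters.
\<close>

lemma hausdorff_outer_le_isometric_image:
  assumes f: "\<And>x. x \<in> X \<Longrightarrow> f x \<in> X" "\<And>x. x \<in> X \<Longrightarrow> f (f x) = x"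
      "\<And>x y. x \<in> X \<Longrightarrow> y \<in> X \<Longrightarrow> \<rho> (f x) (f y) = \<rho> x y"
    and A: "A \<subseteq> X"
  shows "hausdorff_outer X \<rho> m A \<le> hausdorff_outer X \<rho> m (f ` A)"
  unfolding hausdorff_outer_def
proof (rule SUP_mono', rule INF_greatest, clarify)
  fix \<delta> :: real and U :: "nat \<Rightarrow> 'a set"
  assume U: "\<forall>i. U i \<subseteq> X \<and> ediam \<rho> (U i) \<le> ennreal \<delta>" "f ` A \<subseteq> (\<Union>i. U i)"
  define V where "V = (\<lambda>i. f ` U i)"
  have diam: "ediam \<rho> (V i) = ediam \<rho> (U i)" for i
    unfolding ediam_def V_def image_image using U(1) f(3)
    by (intro SUP_cong refl) (auto simp: subset_iff)
  have "hausdorff_gauge \<rho> m (V i) = hausdorff_gauge \<rho> m (U i)" for i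
    unfolding hausdorff_gauge_def diam by (simp add: V_def)
  moreover have "A \<subseteq> (\<Union>i. V i)"
  proof
    fix a assume a: "a \<in> A"
    then obtain i where "f a \<in> U i" using U(2) by auto
    then have "f (f a) \<in> V i" by (simp add: V_def)
    moreover have "f (f a) = a" using a A f(2) by blast
    ultimately show "a \<in> (\<Union>i. V i)" by auto
  qed
  moreover have "V i \<subseteq> X" for i using U(1) f(1) by (auto simp: V_def)
  ultimately show "(INF U\<in>{U. (\<forall>i. U i \<subseteq> X \<and> ediam \<rho> (U i) \<le> ennreal \<delta>) \<and> A \<subseteq> (\<Union>i. U i)}.
      suminf (\<lambda>i. hausdorff_gauge \<rho> m (U i))) \<le> suminf (\<lambda>i. hausdorff_gauge \<rho> m (U i))"
    using U(1) by (intro INF_lower2[of V]) (auto simp: diam)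
qed

lemma sets_hausdorff_measure_hyp:
  assumes K: "K < 0"
  shows "sets (hausdorff_measure (hyp K d) (hyp_dist K) m) = sigma_sets (hyp K d) {U. openin (hyp_top K d) U}"
  unfolding hausdorff_measure_def hyp_top_def[symmetric]
  using openin_subset[of "hyp_top K d"] K by (intro sets_measure_of) auto

lemma closedin_hausdorff_measurable:
  assumes K: "K < 0" and C: "closedin (hyp_top K d) C"
  shows "C \<in> sets (hausdorff_measure (hyp K d) (hyp_dist K) m)"
proof -
  have "hyp K d - (hyp K d - C) \<in> sigma_sets (hyp K d) {U. openin (hyp_top K d) U}"
    using C K by (intro sigma_sets.Compl sigma_sets.Basic) (auto simp: closedin_def)
  moreover have "hyp K d - (hyp K d - C) = C"
    using closedin_subset[OF C] K by auto
  ultimately show ?thesis by (simp add: sets_hausdorff_measure_hyp[OF K])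
qed

lemma shell_measurable:
  assumes K: "K < 0" and L: "closedin (hyp_top K d) L"
  shows "{x \<in> L. hyp_dist K x 0 < s} \<in> sets (hausdorff_measure (hyp K d) (hyp_dist K) m)"
    and "{x \<in> L. s \<le> hyp_dist K x 0 \<and> hyp_dist K x 0 \<le> t} \<in> sets (hausdorff_measure (hyp K d) (hyp_dist K) m)"
proof -
  interpret Metric_space "hyp K d" "hyp_dist K" by (rule Metric_space_hyp[OF K])
  let ?H = "hausdorff_measure (hyp K d) (hyp_dist K) m"
  have LX: "L \<subseteq> hyp K d" using closedin_subset[OF L] K by simp
  have L': "L \<in> sets ?H" by (rule closedin_hausdorff_measurable[OF K L])
  have "mball 0 s \<in> sets ?H"
    unfolding sets_hausdorff_measure_hyp[OF K] by (auto simp: hyp_top_def)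
  moreover have "mcball 0 t \<in> sets ?H"
    using closedin_mcball by (intro closedin_hausdorff_measurable[OF K]) (simp add: hyp_top_def)
  moreover have "{x \<in> L. hyp_dist K x 0 < s} = L \<inter> mball 0 s"
    "{x \<in> L. s \<le> hyp_dist K x 0 \<and> hyp_dist K x 0 \<le> t} = L \<inter> mcball 0 t - mball 0 s"
    using LX K by (auto simp: hyp_dist_commute[of K 0])
  ultimately show "{x \<in> L. hyp_dist K x 0 < s} \<in> sets ?H"
      "{x \<in> L. s \<le> hyp_dist K x 0 \<and> hyp_dist K x 0 \<le> t} \<in> sets ?H"
    using L' by auto
qed

text \<open>
  The Euclidean norm \<open>tanh (\<surd>(-K) t) / \<surd>(-K)\<close> corresponds to the distance \<open>t\<close> from the origin.
\<close>

lemma exists_point_at_distance: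
  assumes K: "K < 0" and V: "subspace V" "V \<subseteq> coord_space d" "0 < dim V" and t: "0 \<le> t"
  obtains p where "p \<in> V" "p \<in> hyp K d" "hyp_dist K p 0 = t"
proof -
  have "V \<noteq> {0}"
  proof
    assume "V = {0}"
    then have "V = span {}" by simp
    then have "dim V = card ({} :: point set)" using real_vector.dim_span_eq_card_independent[of "{}"]
      by (simp add: real_vector.independent_empty)
    then show False using V(3) by simp
  qed
  then obtain v where v: "v \<in> V" "v \<noteq> 0" using subspace_0[OF V(1)] by blast
  define T where "T = tanh (sqrt (- K) * t)"
  define p where "p = (T / sqrt (- K) / sqrt (ip v v)) *\<^sub>R v"
  have "ip p p = (T / sqrt (- K) / sqrt (ip v v))\<^sup>2 * ip v v"
    by (simp add: p_def ip_linear power2_eq_square)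
  also have "\<dots> = T\<^sup>2 / - K"
    using K v(2) by (simp add: power_divide power_mult_distrib)
  finally have "lor K p p = 1 - T\<^sup>2"
    using K by (simp add: lor_def)
  also have "\<dots> = 1 / (cosh (sqrt (- K) * t))\<^sup>2"
    unfolding T_def tanh_def by (simp add: power_divide sinh_square_eq diff_divide_distrib)
  finally have lor: "lor K p p = 1 / (cosh (sqrt (- K) * t))\<^sup>2" .
  then have pos: "0 < lor K p p" by (simp add: zero_less_power)
  have p: "p \<in> V" unfolding p_def using subspace_scale[OF V(1) v(1)] by blast
  have "cosh (sqrt (- K) * hyp_dist K p 0) = cosh (sqrt (- K) * t)"
    using cosh_hyp_dist_origin[OF K pos] by (simp add: lor real_sqrt_divide)
  then have "sqrt (- K) * hyp_dist K p 0 = sqrt (- K) * t"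
    using K t by (metis arcosh_cosh_real hyp_dist_nonneg mult_nonneg_nonneg
        neg_0_le_iff_le less_imp_le real_sqrt_ge_zero)
  then show ?thesis using that[of p] p pos K V(2) by (auto simp: hyp_iff)
qed

text \<open>
  The reflection exchanging the origin with a point of \<open>L\<close> at distance \<open>3 r\<close> preserves \<open>L\<close> and maps the
  ball of radius \<open>r\<close> into the shell, by the triangle inequality.
\<close>

lemma hausdorff_ball_le_shell:
  assumes K: "K < 0" and L: "L \<in> flats0 K d k" and k: "0 < k" and r: "0 < r"
  shows "emeasure (hausdorff_measure (hyp K d) (hyp_dist K) m) {x \<in> L. hyp_dist K x 0 < r}
    \<le> emeasure (hausdorff_measure (hyp K d) (hyp_dist K) m)
        {x \<in> L. 2 * r \<le> hyp_dist K x 0 \<and> hyp_dist K x 0 \<le> 4 * r}"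
    (is "emeasure ?H ?A \<le> emeasure ?H ?B")
proof -
  obtain V where V: "subspace V" "V \<subseteq> coord_space d" "dim V = k" "L = V \<inter> hyp K d"
    using L flats0_iff[OF K] by auto
  obtain p where p: "p \<in> V" "p \<in> hyp K d" "hyp_dist K p 0 = 3 * r"
    using exists_point_at_distance[OF K V(1,2), of "3 * r"] V(3) k r by auto
  let ?f = "swap_origin K p"
  have "?f x \<in> ?B" if x: "x \<in> ?A" for x
  proof -
    have xh: "x \<in> V" "x \<in> hyp K d" "hyp_dist K x 0 < r" using x V(4) by auto
    have fx: "?f x \<in> V" "?f x \<in> hyp K d"
      using swap_origin_subspace[OF K p(2) V(1) p(1) xh(1)] swap_origin_in_hyp[OF K p(2) xh(2)] by auto
    have "hyp_dist K (?f x) 0 = hyp_dist K x p"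
      using hyp_dist_swap_origin[OF K p(2) fx(2), of 0] swap_origin_involutive[OF K p(2) xh(2)]
        swap_origin_0[OF K p(2)] K by simp
    moreover have "hyp_dist K p 0 \<le> hyp_dist K x p + hyp_dist K x 0"
        "hyp_dist K x p \<le> hyp_dist K x 0 + hyp_dist K p 0"
      using hyp_dist_triangle[OF K p(2) xh(2) zero_in_hyp[OF K]]
        hyp_dist_triangle[OF K xh(2) zero_in_hyp[OF K] p(2)]
      by (simp_all add: hyp_dist_commute[of K p x] hyp_dist_commute[of K 0 p])
    ultimately show ?thesis using fx V(4) xh(3) p(3) by auto
  qed
  then have "hausdorff_outer (hyp K d) (hyp_dist K) m (?f ` ?A)
      \<le> hausdorff_outer (hyp K d) (hyp_dist K) m ?B"
    by (intro hausdorff_outer_mono) auto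
  moreover have "hausdorff_outer (hyp K d) (hyp_dist K) m ?A
      \<le> hausdorff_outer (hyp K d) (hyp_dist K) m (?f ` ?A)"
    using V(4) by (intro hausdorff_outer_le_isometric_image swap_origin_in_hyp[OF K p(2)]
        swap_origin_involutive[OF K p(2)] hyp_dist_swap_origin[OF K p(2)]) auto
  moreover have "?B \<in> sets ?H"
    using closedin_flat[OF K] L by (intro shell_measurable[OF K]) (auto simp: flats0_def)
  then have "?B \<in> sigma_sets (hyp K d) {U. openin (hyp_top K d) U}"
    by (simp only: sets_hausdorff_measure_hyp[OF K])
  ultimately show ?thesis
    unfolding hausdorff_measure_def hyp_top_def[symmetric] emeasure_measure_of_conv
    by auto
qed

text \<open>
  The weight is at most \<open>cosh\<^sup>n(\<surd>(-K) r)\<close> on the ball and at least \<open>cosh\<^sup>n(2 \<surd>(-K) r)\<close> on the shell, and the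
  ball has at most the volume of the shell.  In the application \<open>g\<close> is the map from foot points to
  flats.
\<close>

lemma weighted_ball_le:
  assumes K: "K < 0" and L: "L \<in> flats0 K d k" and k: "0 < k" and r: "0 < r"
    and near: "\<And>x. x \<in> L \<Longrightarrow> g x \<in> B \<Longrightarrow> hyp_dist K x 0 < r"
    and far: "\<And>x. x \<in> L \<Longrightarrow> hyp_dist K x 0 \<le> 4 * r \<Longrightarrow> g x \<in> B'"
  shows "(\<integral>\<^sup>+ x\<in>L. indicator B (g x) * ennreal (cosh (sqrt (- K) * hyp_dist K x 0) ^ n)
        \<partial>hausdorff_measure (hyp K d) (hyp_dist K) m)
    \<le> ennreal ((cosh (sqrt (- K) * r) / cosh (sqrt (- K) * (2 * r))) ^ n) *
      (\<integral>\<^sup>+ x\<in>L. indicator B' (g x) * ennreal (cosh (sqrt (- K) * hyp_dist K x 0) ^ n)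
        \<partial>hausdorff_measure (hyp K d) (hyp_dist K) m)"
proof -
  let ?H = "hausdorff_measure (hyp K d) (hyp_dist K) m"
  let ?w = "\<lambda>t. cosh (sqrt (- K) * t) ^ n"
  define A where "A = {x \<in> L. hyp_dist K x 0 < r}"
  define S where "S = {x \<in> L. 2 * r \<le> hyp_dist K x 0 \<and> hyp_dist K x 0 \<le> 4 * r}"
  have w_mono: "?w s \<le> ?w t" if "0 \<le> s" "s \<le> t" for s t
    using that K by (intro power_mono) (auto simp: cosh_real_nonneg_le_iff intro!: mult_left_mono)
  have closed: "closedin (hyp_top K d) L" using closedin_flat[OF K] L by (auto simp: flats0_def)
  have meas: "A \<in> sets ?H" "S \<in> sets ?H"
    using shell_measurable[OF K closed] by (auto simp: A_def S_def)
  have "(\<integral>\<^sup>+ x\<in>L. indicator B (g x) * ennreal (?w (hyp_dist K x 0)) \<partial>?H)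
      \<le> (\<integral>\<^sup>+ x. ennreal (?w r) * indicator A x \<partial>?H)"
  proof (rule nn_integral_mono)
    fix x
    show "indicator B (g x) * ennreal (?w (hyp_dist K x 0)) * indicator L x
        \<le> ennreal (?w r) * indicator A x"
      using near[of x] w_mono[of "hyp_dist K x 0" r] K
      by (auto simp: A_def indicator_def intro!: ennreal_leI)
  qed
  also have "\<dots> = ennreal (?w r) * emeasure ?H A"
    using meas by (simp add: nn_integral_cmult_indicator)
  also have "\<dots> \<le> ennreal (?w r) * emeasure ?H S"
    unfolding A_def S_def by (intro mult_left_mono hausdorff_ball_le_shell[OF K L k r]) simp
  also have "\<dots> = ennreal ((cosh (sqrt (- K) * r) / cosh (sqrt (- K) * (2 * r))) ^ n)
      * (ennreal (?w (2 * r)) * emeasure ?H S)"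
    by (simp add: power_divide flip: mult.assoc ennreal_mult')
  also have "ennreal (?w (2 * r)) * emeasure ?H S = (\<integral>\<^sup>+ x. ennreal (?w (2 * r)) * indicator S x \<partial>?H)"
    using meas by (simp add: nn_integral_cmult_indicator)
  also have "\<dots> \<le> (\<integral>\<^sup>+ x\<in>L. indicator B' (g x) * ennreal (?w (hyp_dist K x 0)) \<partial>?H)"
  proof (rule nn_integral_mono)
    fix x
    show "ennreal (?w (2 * r)) * indicator S x
        \<le> indicator B' (g x) * ennreal (?w (hyp_dist K x 0)) * indicator L x"
      using far[of x] w_mono[of "2 * r" "hyp_dist K x 0"] r
      by (auto simp: S_def indicator_def intro!: ennreal_leI)
  qed
  finally show ?thesis by (simp add: mult_left_mono)
qed

text \<open>
  The previous comparison is integrated over the directions \<open>L\<close>.  In the application \<open>B'\<close> consists of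
  the flats hitting the ball of radius \<open>4 r\<close>, and \<open>B\<close> of flats with foot point near the origin.
\<close>

lemma flat_measure_near_le:
  assumes K: "K < 0" and m: "0 < m" "m \<le> d" and r: "0 < r" and \<nu>: "space \<nu> = flats0 K d m"
    and B': "B' \<in> sets (flat_measure K d (d - m) \<nu>)"
    and near: "\<And>L x. L \<in> flats0 K d m \<Longrightarrow> x \<in> L \<Longrightarrow> orth_flat K d (d - m) L x \<in> B
      \<Longrightarrow> hyp_dist K x 0 < r"
    and far: "\<And>L x. L \<in> flats0 K d m \<Longrightarrow> x \<in> L \<Longrightarrow> hyp_dist K x 0 \<le> 4 * r
      \<Longrightarrow> orth_flat K d (d - m) L x \<in> B'"
  shows "emeasure (flat_measure K d (d - m) \<nu>) B
    \<le> ennreal ((cosh (sqrt (- K) * r) / cosh (sqrt (- K) * (2 * r))) ^ (d - m))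
      * emeasure (flat_measure K d (d - m) \<nu>) B'"
proof -
  let ?\<rho> = "(cosh (sqrt (- K) * r) / cosh (sqrt (- K) * (2 * r))) ^ (d - m)"
  let ?H = "hausdorff_measure (hyp K d) (hyp_dist K) m"
  define I where "I = (\<lambda>B L. \<integral>\<^sup>+ x\<in>L. indicator B (orth_flat K d (d - m) L x) *
    ennreal (cosh (sqrt (- K) * hyp_dist K x 0) ^ (d - m)) \<partial>?H)"
  have dm: "d - (d - m) = m" using m by simp
  have "(\<integral>\<^sup>+ L. I B L \<partial>\<nu>) \<le> (\<integral>\<^sup>+ L. ennreal ?\<rho> * I B' L \<partial>\<nu>)"
    unfolding I_def using near far \<nu>
    by (intro nn_integral_mono weighted_ball_le[OF K _ m(1) r]) auto
  also have "\<dots> \<le> ennreal ?\<rho> * (\<integral>\<^sup>+ L. I B' L \<partial>\<nu>)"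
    by (intro nn_integral_cmult_le) auto
  finally have le: "(\<integral>\<^sup>+ L. I B L \<partial>\<nu>) \<le> ennreal ?\<rho> * (\<integral>\<^sup>+ L. I B' L \<partial>\<nu>)" .
  have "B' \<in> sigma_sets (flats K d (d - m)) (flat_opens K d (flats K d (d - m)))"
    using B' by (simp add: flat_measure_def sets_measure_of flat_opens_Pow)
  \<comment> \<open>where \<open>measure_of\<close> falls back to the value \<open>0\<close>, the inequality is trivial\<close>
  then show ?thesis
    using le unfolding flat_measure_def emeasure_measure_of_conv dm I_def by auto
qed

section \<open>The probability that the flats meet\<close>

text \<open>
  Vectors with rational coordinates; those of norm exceeding \<open>2 \<surd>b\<close> are replaced by \<open>0\<close>, which does not
  affect the approximation of vectors of norm at most \<open>\<surd>b\<close>.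
\<close>

lemma countable_dense_directions:
  assumes b: "0 < b"
  obtains e :: "nat \<Rightarrow> point" where "\<And>n. e n \<in> coord_space d" "\<And>n. ip (e n) (e n) \<le> 4 * b"
    "\<And>x \<eta>. x \<in> coord_space d \<Longrightarrow> ip x x \<le> b \<Longrightarrow> 0 < \<eta> \<Longrightarrow> \<exists>n. ip (x - e n) (x - e n) < \<eta>"
proof -
  define F where "F = (\<lambda>n. \<Sum>i<d. real_of_rat (from_nat n ! i) *\<^sub>R unit_vec i)"
  define e where "e = (\<lambda>n. if ip (F n) (F n) \<le> 4 * b then F n else 0)"
  have coord_F: "coord (F n) i = (if i < d then real_of_rat (from_nat n ! i) else 0)" for n i
    by (simp add: F_def lookup_single when_def if_distrib[of "(*) _"] cong: if_cong)
  have e_in: "e n \<in> coord_space d" for n by (simp add: e_def coord_space_iff coord_F)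
  have e_le: "ip (e n) (e n) \<le> 4 * b" for n using b by (simp add: e_def)
  have dense: "\<exists>n. ip (x - e n) (x - e n) < \<eta>"
    if x: "x \<in> coord_space d" "ip x x \<le> b" and \<eta>: "0 < \<eta>" for x \<eta>
  proof -
    define \<theta> where "\<theta> = min \<eta> b"
    have \<theta>: "0 < \<theta>" "\<theta> \<le> \<eta>" "\<theta> \<le> b" using \<eta> b by (auto simp: \<theta>_def)
    \<comment> \<open>the total squared error over \<open>d\<close> coordinates stays below \<open>\<theta>\<close>\<close>
    define s where "s = sqrt (\<theta> / (d + 1))"
    have s: "0 < s" "s\<^sup>2 = \<theta> / (d + 1)" using \<theta> by (simp_all add: s_def)
    have "\<exists>q. \<bar>coord x i - real_of_rat q\<bar> < s" for i
      using of_rat_dense[of "coord x i - s" "coord x i + s"] s(1) by (auto simp: abs_less_iff algebra_simps)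
    then obtain q where q: "\<And>i. \<bar>coord x i - real_of_rat (q i)\<bar> < s" by metis
    define n where "n = to_nat (map q [0..<d])"
    have F: "coord (F n) i = (if i < d then real_of_rat (q i) else 0)" for i
      by (simp add: coord_F n_def)
    have "x - F n \<in> coord_space d" using x by (simp add: coord_space_iff F lookup_minus)
    then have "ip (x - F n) (x - F n) = (\<Sum>i<d. (coord x i - real_of_rat (q i))\<^sup>2)"
      using ip_eq_sum[of "{..<d}" "x - F n" "x - F n"]
      by (auto simp: coord_space_def lookup_minus F power2_eq_square intro!: sum.cong)
    also have "\<dots> \<le> (\<Sum>i<d. s\<^sup>2)"
    proof (rule sum_mono)
      fix i
      have "\<bar>coord x i - real_of_rat (q i)\<bar>\<^sup>2 \<le> s\<^sup>2"
        using q[of i] by (intro power_mono) auto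
      then show "(coord x i - real_of_rat (q i))\<^sup>2 \<le> s\<^sup>2" by simp
    qed
    also have "\<dots> = d * (\<theta> / (d + 1))" using s(2) by simp
    also have "\<dots> < \<theta>" using \<theta>(1) by (simp add: field_simps)
    finally have close: "ip (x - F n) (x - F n) < \<theta>" .
    have "0 \<le> ip (2 *\<^sub>R x - F n) (2 *\<^sub>R x - F n)" by (rule ip_self_nonneg)
    then have "ip (F n) (F n) \<le> 2 * ip x x + 2 * ip (x - F n) (x - F n)"
      by (simp add: ip_linear ip_commute[of "F n" x])
    then have "ip (F n) (F n) \<le> 4 * b" using x(2) close \<theta>(3) by linarith
    then have "e n = F n" by (simp add: e_def)
    then show ?thesis using close \<theta>(2) by (metis less_le_trans)
  qed
  show ?thesis using that e_in e_le dense by blast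
qed

text \<open>
  A flat with foot point \<open>x\<close> lies in such a class for every \<open>e\<close> close to \<open>x\<close>.  The foot point itself does
  not occur, which makes measurability immediate and allows countably many \<open>e\<close> to suffice.
\<close>

definition beyond_flats :: "real \<Rightarrow> nat \<Rightarrow> nat \<Rightarrow> real \<Rightarrow> point \<Rightarrow> point set set" where
  "beyond_flats K d k c e = {E \<in> flats K d k. \<forall>z\<in>E. c \<le> ip z e}"

lemma beyond_flats_measurable:
  assumes K: "K < 0"
  shows "beyond_flats K d k c e \<in> sets (flats_borel K d k)"
proof -
  have "beyond_flats K d k c e
      = space (flats_borel K d k) - {E \<in> flats K d k. E \<inter> {x \<in> hyp K d. ip x e < c} \<noteq> {}}"
  proof -
    have "E \<subseteq> hyp K d" if "E \<in> flats K d k" for E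
      using that by (auto simp: flats_def)
    then show ?thesis by (fastforce simp: beyond_flats_def not_less)
  qed
  also have "\<dots> \<in> sets (flats_borel K d k)"
    by (intro sets.compl_sets flats_borel_hitting[OF K] open_halfspace[OF K])
  finally show ?thesis .
qed

text \<open>
  This is \<open>cosh_hyp_dist_origin\<close> solved for the Euclidean norm.
\<close>

lemma ip_ge_of_hyp_dist_ge:
  assumes K: "K < 0" and x: "0 < lor K x x" and r: "0 \<le> r" "r \<le> hyp_dist K x 0"
  shows "(1 - 1 / (cosh (sqrt (- K) * r))\<^sup>2) / - K \<le> ip x x"
proof -
  have "cosh (sqrt (- K) * r) \<le> cosh (sqrt (- K) * hyp_dist K x 0)"
    using K r by (subst cosh_real_nonneg_le_iff) (auto intro!: mult_left_mono)
  then have "(cosh (sqrt (- K) * r))\<^sup>2 \<le> (1 / sqrt (lor K x x))\<^sup>2"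
    using cosh_hyp_dist_origin[OF K x] by (intro power_mono) auto
  also have "\<dots> = 1 / lor K x x" using x by (simp add: power_divide)
  finally have "lor K x x \<le> 1 / (cosh (sqrt (- K) * r))\<^sup>2"
    using x by (simp add: field_simps)
  then have "1 - 1 / (cosh (sqrt (- K) * r))\<^sup>2 \<le> ip x x * - K"
    by (simp add: lor_def mult.commute[of K])
  then show ?thesis using K by (subst pos_divide_le_eq) auto
qed

text \<open>
  On the flat the product with \<open>x\<close> has the constant value \<open>\<bar>x\<bar>\<^sup>2 \<ge> a\<close>.  Points of the ball have norm at
  most \<open>1 / \<surd>(-K)\<close>, so replacing \<open>x\<close> by \<open>e\<close> changes the product by at most \<open>a / 2\<close>.
\<close>

lemma orth_flat_beyond:
  assumes K: "K < 0" and L: "L \<in> flats0 K d m" and x: "x \<in> L"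
    and a: "0 < a" "a \<le> ip x x"
    and e: "e \<in> coord_space d" "ip (x - e) (x - e) \<le> a\<^sup>2 / 4 * - K"
  shows "orth_flat K d (d - m) L x \<in> beyond_flats K d (d - m) (a / 2) e"
proof -
  obtain V where V: "subspace V" "V \<subseteq> coord_space d" "dim V = m" "L = V \<inter> hyp K d"
    using L flats0_iff[OF K] by auto
  have xV: "x \<in> V" "x \<in> hyp K d" using x V(4) by auto
  define E where "E = {y \<in> hyp K d. y - x \<in> orth_compl d V}"
  have eq: "orth_flat K d (d - m) L x = E"
    unfolding V(4) E_def by (rule orth_flat_eq[OF K V(1-3) xV])
  have "E \<in> flats K d (d - m)"
    using orthogonal_slice_flat[OF K V(1,2) xV(2)] V(3) by (simp add: E_def)
  moreover have "a / 2 \<le> ip z e" if z: "z \<in> E" for z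
  proof -
    have "ip (z - x) x = 0" using z xV(1) by (simp add: E_def orth_compl_def)
    then have zx: "a \<le> ip z x" using a by (simp add: ip_diff_left)
    have "0 < lor K z z" using z K by (simp add: E_def hyp_iff)
    then have "ip z z * - K \<le> 1" by (simp add: lor_def mult.commute)
    then have "ip z z \<le> 1 / - K" using K by (subst pos_le_divide_eq) auto
    then have "ip z z * ip (x - e) (x - e) \<le> 1 / - K * (a\<^sup>2 / 4 * - K)"
      using K e(2) by (intro mult_mono) auto
    have "(ip z (x - e))\<^sup>2 \<le> (a / 2)\<^sup>2"
    proof -
      have "1 / - K * (a\<^sup>2 / 4 * - K) = (a / 2)\<^sup>2" using K by (simp add: power_divide)
      then show ?thesis using \<open>ip z z * _ \<le> 1 / - K * _\<close> ip_Cauchy_Schwarz[of z "x - e"] by linarith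
    qed
    then have "ip z (x - e) \<le> a / 2"
      by (rule power2_le_imp_le) (use a(1) in simp)
    then show ?thesis using zx by (simp add: ip_diff_right)
  qed
  ultimately show ?thesis by (simp add: eq beyond_flats_def)
qed

text \<open>
  A flat outside all classes has its foot point at distance less than \<open>r\<close>, because a foot point
  further away is approximated by some \<open>e n\<close>.  The parameter \<open>a\<close> is the squared Euclidean norm of the
  points at distance \<open>r\<close> from the origin.
\<close>

lemma uniform_near_flats_le:
  fixes e :: "nat \<Rightarrow> point"
  assumes K: "K < 0" and m: "0 < m" "m \<le> d" and r: "0 < r" and \<nu>: "space \<nu> = flats0 K d m"
    and U: "prob_space (uniform_measure (flat_measure K d (d - m) \<nu>) (hitting_flats K d (d - m) (4 * r)))"
    and a: "a = (1 - 1 / (cosh (sqrt (- K) * r))\<^sup>2) / - K" and a_pos: "0 < a"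
    and e: "\<And>n. e n \<in> coord_space d"
      "\<And>x \<eta>. x \<in> coord_space d \<Longrightarrow> ip x x \<le> 1 / - K \<Longrightarrow> 0 < \<eta> \<Longrightarrow> \<exists>n. ip (x - e n) (x - e n) < \<eta>"
  shows "emeasure (uniform_measure (flat_measure K d (d - m) \<nu>) (hitting_flats K d (d - m) (4 * r)))
      (flats K d (d - m) - (\<Union>n. beyond_flats K d (d - m) (a / 2) (e n)))
    \<le> ennreal ((cosh (sqrt (- K) * r) / cosh (sqrt (- K) * (2 * r))) ^ (d - m))"
proof -
  let ?k = "d - m"
  let ?N = "flats_borel K d ?k"
  let ?\<mu> = "flat_measure K d ?k \<nu>" and ?H = "hitting_flats K d ?k (4 * r)"
  let ?\<rho> = "(cosh (sqrt (- K) * r) / cosh (sqrt (- K) * (2 * r))) ^ ?k"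
  define C where "C = (\<lambda>n. beyond_flats K d ?k (a / 2) (e n))"
  define B where "B = flats K d ?k - (\<Union>n. C n)"
  have C [measurable]: "C n \<in> sets ?N" for n
    unfolding C_def by (rule beyond_flats_measurable[OF K])
  have "space ?N - (\<Union>n. C n) \<in> sets ?N" by measurable
  then have B: "B \<in> sets ?N" by (simp add: B_def)
  note H = prob_space_uniform_measureD[OF U]
  have sets_\<mu>: "sets ?\<mu> = sets ?N"
    by (simp add: flat_measure_def sets_measure_of flat_opens_Pow sets_flats_borel)
  have "emeasure ?\<mu> (?H \<inter> B) \<le> ennreal ?\<rho> * emeasure ?\<mu> ?H"
  proof (rule flat_measure_near_le[OF K m r \<nu> H(1)])
    fix L x assume L: "L \<in> flats0 K d m" and x: "x \<in> L"
    obtain V where V: "subspace V" "V \<subseteq> coord_space d" "dim V = m" "L = V \<inter> hyp K d"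
      using L flats0_iff[OF K] by auto
    have xV: "x \<in> V" "x \<in> coord_space d" "x \<in> hyp K d" "0 < lor K x x"
      using x V(4) K by (auto simp: hyp_iff)
    show "hyp_dist K x 0 < r" if orth: "orth_flat K d ?k L x \<in> ?H \<inter> B"
    proof (rule ccontr)
      assume "\<not> hyp_dist K x 0 < r"
      then have ax: "a \<le> ip x x"
        unfolding a using xV(4) r by (intro ip_ge_of_hyp_dist_ge[OF K]) auto
      have "ip x x * - K \<le> 1" using xV(4) by (simp add: lor_def mult.commute)
      then have "ip x x \<le> 1 / - K" using K by (subst pos_le_divide_eq) auto
      moreover have "0 < a\<^sup>2 / 4 * - K" using a_pos K by (intro mult_pos_pos) auto
      ultimately obtain n where "ip (x - e n) (x - e n) < a\<^sup>2 / 4 * - K"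
        using e(2) xV(2) by blast
      then have "orth_flat K d ?k L x \<in> C n"
        unfolding C_def by (intro orth_flat_beyond[OF K L x a_pos ax e(1)]) simp
      then show False using orth by (auto simp: B_def)
    qed
    show "orth_flat K d ?k L x \<in> ?H" if "hyp_dist K x 0 \<le> 4 * r"
    proof -
      have eq: "orth_flat K d ?k L x = {y \<in> hyp K d. y - x \<in> orth_compl d V}"
        unfolding V(4) by (rule orth_flat_eq[OF K V(1-3) xV(1,3)])
      have "orth_flat K d ?k L x \<in> flats K d ?k"
        using orthogonal_slice_flat[OF K V(1,2) xV(3)] V(3) by (simp add: eq)
      moreover have "x \<in> orth_flat K d ?k L x"
        unfolding eq using xV(3) subspace_0[OF subspace_orth_compl] by simp
      ultimately show ?thesis
        using that xV(3) by (auto simp: hitting_flats_def hyp_cball_def)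
    qed
  qed
  then have "emeasure ?\<mu> (?H \<inter> B) / emeasure ?\<mu> ?H \<le> ennreal ?\<rho> * emeasure ?\<mu> ?H / emeasure ?\<mu> ?H"
    by (rule divide_right_mono_ennreal)
  also have "\<dots> = ennreal ?\<rho>" using H(2,3) by (simp add: ennreal_mult_divide_eq)
  finally show ?thesis
    using emeasure_uniform_measure[OF H(1)] B sets_\<mu> by (simp add: B_def C_def)
qed

text \<open>
  The first summand bounds the probability that \<open>E\<close> has its foot point near the origin, the second one
  the probability that \<open>L\<close> reaches the approximate direction of the foot point.
\<close>

lemma prob_hitting_le:
  fixes M :: "'w measure" and L E :: "'w \<Rightarrow> point set"
  assumes K: "K < 0" and m: "0 < m" "m \<le> d" and r: "0 < r"
    and M: "prob_space M"
    and L: "L \<in> measurable M (flats0_borel K d q)"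
    and L_distr: "invariant_probability K d q (distr M (flats0_borel K d q) L)"
    and E: "E \<in> measurable M (flats_borel K d (d - m))"
    and \<nu>: "space \<nu> = flats0 K d m"
    and E_distr: "distr M (flats_borel K d (d - m)) E =
        uniform_measure (flat_measure K d (d - m) \<nu>) (hitting_flats K d (d - m) (4 * r))"
    and indep: "prob_space.indep_var M (flats_borel K d (d - m)) E (flats0_borel K d q) L"
    and a: "a = (1 - 1 / (cosh (sqrt (- K) * r))\<^sup>2) / - K"
  shows "measure M {\<omega> \<in> space M. E \<omega> \<inter> L \<omega> \<noteq> {}}
    \<le> (cosh (sqrt (- K) * r) / cosh (sqrt (- K) * (2 * r))) ^ (d - m)
      + q * (4 / - K) / - K / (a / 4)\<^sup>2 / d"
proof -
  interpret prob_space M by (rule M)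
  let ?k = "d - m"
  let ?N = "flats_borel K d ?k" and ?N' = "flats0_borel K d q"
  let ?\<mu> = "flat_measure K d ?k \<nu>" and ?H = "hitting_flats K d ?k (4 * r)"
  let ?\<rho> = "(cosh (sqrt (- K) * r) / cosh (sqrt (- K) * (2 * r))) ^ ?k"
  let ?\<delta> = "q * (4 / - K) / - K / (a / 4)\<^sup>2 / d"
  have "1 < cosh (sqrt (- K) * r)" using K r cosh_real_strict_mono[of 0 "sqrt (- K) * r"] by simp
  then have "1 / (cosh (sqrt (- K) * r))\<^sup>2 < 1" by (simp add: power2_eq_square less_1_mult)
  then have a_pos: "0 < a" unfolding a using K by (intro divide_pos_pos) auto
  have Kpos: "0 < 1 / - K" using K by simp
  obtain e :: "nat \<Rightarrow> point" where e: "\<And>n. e n \<in> coord_space d" "\<And>n. ip (e n) (e n) \<le> 4 * (1 / - K)"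
    "\<And>x \<eta>. x \<in> coord_space d \<Longrightarrow> ip x x \<le> 1 / - K \<Longrightarrow> 0 < \<eta> \<Longrightarrow> \<exists>n. ip (x - e n) (x - e n) < \<eta>"
    using countable_dense_directions[OF Kpos] by blast
  define C where "C = (\<lambda>n. beyond_flats K d ?k (a / 2) (e n))"
  \<comment> \<open>\<open>E \<in> D n\<close> assigns to \<open>E\<close> the first vector whose class contains it\<close>
  define D where "D = disjointed C"
  \<comment> \<open>the threshold is below \<open>a / 2\<close>, because reaching is defined by a strict inequality\<close>
  define A where "A = (\<lambda>n. reaching_flats K d q (a / 4) (e n))"
  define T where "T = {\<omega> \<in> space M. \<exists>n. E \<omega> \<in> D n \<and> L \<omega> \<in> A n}"
  define B where "B = space ?N - (\<Union>n. C n)"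
  have C [measurable]: "C n \<in> sets ?N" for n
    unfolding C_def by (rule beyond_flats_measurable[OF K])
  have D: "D n \<in> sets ?N" for n
    using sets.range_disjointed_sets[of C ?N] C unfolding D_def by blast
  have A: "A n \<in> sets ?N'" for n
    unfolding A_def by (rule reaching_flats_measurable[OF K])
  have B: "B \<in> sets ?N" unfolding B_def by measurable
  have prob_A: "prob (L -` A n \<inter> space M) \<le> ?\<delta>" for n
  proof -
    have "d * measure (distr M ?N' L) (A n) * (a / 4)\<^sup>2 \<le> q * ip (e n) (e n) / - K"
      unfolding A_def using a_pos by (intro prob_reaching_flats_le[OF K L_distr _ e(1)]) auto
    also have "\<dots> \<le> q * (4 / - K) / - K"
      using e(2)[of n] K by (intro divide_right_mono mult_left_mono) auto
    finally have "d * measure (distr M ?N' L) (A n) * (a / 4)\<^sup>2 \<le> q * (4 / - K) / - K" .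
    moreover have "0 < (a / 4)\<^sup>2" "0 < real d" using a_pos m by auto
    ultimately have "measure (distr M ?N' L) (A n) \<le> ?\<delta>"
      by (simp only: pos_le_divide_eq mult.commute[of "real d"] mult.assoc mult.left_commute)
    then show ?thesis using measure_distr[OF L A] by simp
  qed
  have T: "T \<in> events" "prob T \<le> ?\<delta>"
    unfolding T_def
    by (rule prob_indep_disjoint_UN_le[OF indep D _ A prob_A], simp add: D_def disjoint_family_disjointed)+
  have prob_B: "prob (E -` B \<inter> space M) \<le> ?\<rho>"
  proof -
    have "prob_space (distr M ?N E)" using E by (rule prob_space_distr)
    then have "prob_space (uniform_measure ?\<mu> ?H)" by (simp only: E_distr)
    then have "emeasure (uniform_measure ?\<mu> ?H) B \<le> ennreal ?\<rho>"
      unfolding B_def C_def space_flats_borel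
      by (rule uniform_near_flats_le[OF K m r \<nu> _ a a_pos e(1,3)])
    then have "emeasure (distr M ?N E) B \<le> ennreal ?\<rho>" by (simp only: E_distr)
    then show ?thesis
      using E B by (simp add: emeasure_distr emeasure_eq_measure)
  qed
  have "{\<omega> \<in> space M. E \<omega> \<inter> L \<omega> \<noteq> {}} \<subseteq> (E -` B \<inter> space M) \<union> T"
  proof
    fix \<omega> assume \<omega>: "\<omega> \<in> {\<omega> \<in> space M. E \<omega> \<inter> L \<omega> \<noteq> {}}"
    then obtain y where y: "\<omega> \<in> space M" "y \<in> E \<omega>" "y \<in> L \<omega>" by blast
    show "\<omega> \<in> (E -` B \<inter> space M) \<union> T"
    proof (cases "E \<omega> \<in> B")
      case False
      then have "E \<omega> \<in> (\<Union>n. D n)"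
        using measurable_space[OF E y(1)] by (auto simp: B_def D_def UN_disjointed_eq)
      then obtain n where n: "E \<omega> \<in> D n" by blast
      then have "E \<omega> \<in> C n" using disjointed_subset[of C n] by (auto simp: D_def)
      then have "a / 2 \<le> ip y (e n)" using y(2) by (simp add: C_def beyond_flats_def)
      then have "a / 4 < ip y (e n)" using a_pos by linarith
      then have "L \<omega> \<in> A n"
        using measurable_space[OF L y(1)] y(3) by (auto simp: A_def reaching_flats_def)
      then show ?thesis using n y(1) by (auto simp: T_def)
    qed (use y in auto)
  qed
  moreover have EB: "E -` B \<inter> space M \<in> events" using E B by (rule measurable_sets)
  ultimately have "prob {\<omega> \<in> space M. E \<omega> \<inter> L \<omega> \<noteq> {}} \<le> prob ((E -` B \<inter> space M) \<union> T)"
    using T(1) by (intro finite_measure_mono) auto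
  also have "\<dots> \<le> prob (E -` B \<inter> space M) + prob T"
    using EB T(1) by (rule measure_Un_le)
  also have "\<dots> \<le> ?\<rho> + ?\<delta>" using prob_B T(2) by (rule add_mono)
  finally show ?thesis .
qed

theorem corollary3p2:
  fixes q \<gamma> :: nat and u K :: real
    and \<nu> :: "nat \<Rightarrow> nat \<Rightarrow> point set measure"
    and M :: "nat \<Rightarrow> 'w measure"
    and L E :: "nat \<Rightarrow> 'w \<Rightarrow> point set"
  assumes "q \<ge> 1" and "\<gamma> \<in> {0..q - 1}" and "u > 0" and "K < 0"
    and \<nu>: "\<And>d k. k \<le> d \<Longrightarrow> invariant_probability K d k (\<nu> d k)"
    and M: "\<And>d. d \<ge> q + 1 \<Longrightarrow> prob_space (M d)"
    and L: "\<And>d. d \<ge> q + 1 \<Longrightarrow> L d \<in> measurable (M d) (flats0_borel K d q)"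
    and L_distr: "\<And>d. d \<ge> q + 1 \<Longrightarrow> distr (M d) (flats0_borel K d q) (L d) = \<nu> d q"
    and E: "\<And>d. d \<ge> q + 1 \<Longrightarrow> E d \<in> measurable (M d) (flats_borel K d (d - q + \<gamma>))"
    and E_distr: "\<And>d. d \<ge> q + 1 \<Longrightarrow>
      distr (M d) (flats_borel K d (d - q + \<gamma>)) (E d) =
        uniform_measure (flat_measure K d (d - q + \<gamma>) (\<nu> d (d - (d - q + \<gamma>))))
          (hitting_flats K d (d - q + \<gamma>) u)"
    and indep: "\<And>d. d \<ge> q + 1 \<Longrightarrow>
      prob_space.indep_var (M d) (flats_borel K d (d - q + \<gamma>)) (E d) (flats0_borel K d q) (L d)"
  shows "(\<lambda>d. measure (M d) {\<omega> \<in> space (M d). E d \<omega> \<inter> L d \<omega> \<noteq> {}}) \<longlonglongrightarrow> 0"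
proof -
  define m where "m = q - \<gamma>"
  define r where "r = u / 4"
  define \<rho> where "\<rho> = cosh (sqrt (- K) * r) / cosh (sqrt (- K) * (2 * r))"
  define a where "a = (1 - 1 / (cosh (sqrt (- K) * r))\<^sup>2) / - K"
  define c where "c = q * (4 / - K) / - K / (a / 4)\<^sup>2"
  have m: "0 < m" "m \<le> q" using assms(1,2) by (auto simp: m_def)
  have r: "0 < r" "u = 4 * r" using \<open>u > 0\<close> by (simp_all add: r_def)
  have bound: "measure (M d) {\<omega> \<in> space (M d). E d \<omega> \<inter> L d \<omega> \<noteq> {}} \<le> \<rho> ^ (d - m) + c / d"
    if d: "d \<ge> q + 1" for d
  proof -
    have k: "d - q + \<gamma> = d - m" using d assms(1,2) by (auto simp: m_def)
    have dm: "d - (d - m) = m" using d m(2) by simp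
    have "space (\<nu> d m) = flats0 K d m"
      using \<nu>[of m d] d m(2) by (simp add: invariant_probability_def)
    moreover have "invariant_probability K d q (distr (M d) (flats0_borel K d q) (L d))"
      using \<nu>[of q d] d by (simp add: L_distr[OF d])
    ultimately show ?thesis
      using prob_hitting_le[OF \<open>K < 0\<close> m(1) _ r(1) M[OF d] L[OF d] _ E[OF d, unfolded k]
          _ E_distr[OF d, unfolded k dm r(2)] indep[OF d, unfolded k] a_def] d m(2)
      unfolding \<rho>_def c_def by auto
  qed
  have "cosh (sqrt (- K) * r) < cosh (sqrt (- K) * (2 * r))"
    using \<open>K < 0\<close> r(1) by (intro cosh_real_strict_mono) auto
  then have \<rho>: "0 \<le> \<rho>" "\<rho> < 1" by (simp_all add: \<rho>_def)
  have "(\<lambda>d. \<rho> ^ (d - m)) \<longlonglongrightarrow> 0"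
    using LIMSEQ_realpow_zero[OF \<rho>] LIMSEQ_offset[of "\<lambda>d. \<rho> ^ (d - m)" m 0] by simp
  moreover have "(\<lambda>d. c / real d) \<longlonglongrightarrow> 0" by (rule lim_const_over_n)
  ultimately have lim: "(\<lambda>d. \<rho> ^ (d - m) + c / real d) \<longlonglongrightarrow> 0"
    using tendsto_add by fastforce
  show ?thesis
  proof (rule tendsto_sandwich[OF _ _ tendsto_const lim])
    show "\<forall>\<^sub>F d in sequentially. measure (M d) {\<omega> \<in> space (M d). E d \<omega> \<inter> L d \<omega> \<noteq> {}}
        \<le> \<rho> ^ (d - m) + c / real d"
      using bound by (rule eventually_sequentiallyI)
  qed simp
qed

end
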